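(* Let $n,m\ge 1$, $h>0$, $\alpha\ge 0$, $\sigma>0$, $L>0$, $M>0$, $\varepsilon_m\ge 0$. Suppose $|Y|\le M$. Let $\mathcal{G}_m=\{\|\hat p_\sigma-p_\sigma\|_\infty\le\varepsilon_m\}$ (an event depending only on the unlabeled data) and suppose that $\mathbb{P}(\mathcal{G}_m^c)\le 1/m$. Then for every $P\in\mathcal{P}(\alpha,\sigma,L)$, $$R_P(\hat f_{h,\alpha,\sigma})\le L^2\left(h e^{\alpha\varepsilon_m}\right)^2+\frac{M^2\left(2+\frac1e\right)\mathcal{N}\left(P,\alpha,\sigma,e^{-\varepsilon_m\alpha}h/2\right)}{n}+\frac{4M^2}{m}.$$
   Context: Data: $\mathcal{X}=[0,1]^d$. $(X_1,Y_1),\dots,(X_n,Y_n)$ are i.i.d. from a distribution $P$ on $\mathcal X\times\mathbb{R}$ (labeled data), and $X_{n+1},\dots,X_N$ are i.i.d. from the $X$-marginal $P_X$ of $P$ (unlabeled data), independent of the labeled data; $m=N-n$. The regression function is $f(x)=f_P(x)=\mathbb{E}(Y|X=x)$. $S_P$ denotes the support of $P_X$. Smoothed density: $K$ is a symmetric kernel (probability density) on $\mathbb{R}^d$ with compact support, and $p_\sigma(x)=p_{X,\sigma}(x)=\int \sigma^{-d}K(\|x-u\|/\sigma)\,dP_X(u)$. Its estimate from the unlabeled data is $\hat p_\sigma(x)=\frac1m\sum_{i=1}^m \sigma^{-d}K(\|x-X_{i+n}\|/\sigma)$. $\|\cdot\|_\infty$ is the sup norm over $\mathbb{R}^d$. Density-sensitive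 metric: let $\Gamma(x_1,x_2)$ be the set of continuous finite-length curves $\gamma$ from $x_1$ to $x_2$ with unit speed everywhere, $L(\gamma)$ the length of $\gamma$ (so $\gamma(0)=x_1$, $\gamma(L(\gamma))=x_2$). Define $D_{P,\alpha,\sigma}(x_1,x_2)=\inf_{\gamma\in\Gamma(x_1,x_2)}\int_0^{L(\gamma)}\exp[-\alpha p_{X,\sigma}(\gamma(t))]\,dt$, and $\hat D_{\alpha,\sigma}$ by the same formula with $\hat p_\sigma$ in place of $p_{X,\sigma}$. Class: $\mathcal{P}(\alpha,\sigma,L)$ is the set of joint distributions $P$ of $(X,Y)$ such that $P_X$ is supported on $\mathcal{X}$ and $|f_P(x_1)-f_P(x_2)|\le L\,D_{P,\alpha,\sigma}(x_1,x_2)$ for all $x_1,x_2\in\mathcal{X}$. Covering number: $\mathcal{N}(P,\alpha,\sigma,\varepsilon)$ is the smallest number of balls $\{z: D_{P,\alpha,\sigma}(x,z)\le\varepsilon\}$ required to cover $S_P$. Estimator: with $Q(x)=I(\|x\|\le1)$ and $Q_h(x)=h^{-d}Q(x/h)$, $$\hat f_{h,\alpha,\sigma}(x)=\frac{\sum_{i=1}^n Y_i\,Q_h(\hat D_{\alpha,\sigma}(x,X_i))}{\sum_{i=1}^n Q_h(\hat D_{\alpha,\sigma}(x,X_i))},$$ with the convention $0/0=0$. Risk: $R_P(\hat f)=\mathbb{E}_P\left[\int(\hat f(x)-f_P(x))^2\,dP_X(x)\right]$, the expectation being over all the (labeled and unlabeled) data. *)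

theory Defs
  imports "HOL-Probability.Probability"
begin

section \<open>The distribution and its regression function\<close>

definition unit_cube :: "(real ^ 'd::finite) set" where
  "unit_cube = {x. \<forall>i. 0 \<le> x $ i \<and> x $ i \<le> 1}"

definition X_marginal :: "((real ^ 'd::finite) \<times> real) measure \<Rightarrow> (real ^ 'd) measure" where
  "X_marginal P = distr P borel fst"

definition measure_support :: "'a::topological_space measure \<Rightarrow> 'a set" where
  "measure_support \<mu> = {x. \<forall>U. open U \<and> x \<in> U \<longrightarrow> emeasure \<mu> U > 0}"

text \<open>
  The function \<open>x \<mapsto> E(Y | X = x)\<close> is determined only up to \<open>P\<^sub>X\<close>-null sets, so it is
  represented by the predicate ``\<open>f\<close> is a version of the regression function of \<open>P\<close>''.
\<close>

definition regression_version ::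
  "((real ^ 'd::finite) \<times> real) measure \<Rightarrow> (real ^ 'd \<Rightarrow> real) \<Rightarrow> bool" where
  "regression_version P f \<longleftrightarrow>
     integrable P snd \<and> f \<in> borel_measurable borel \<and>
     (AE z in P. real_cond_exp P (vimage_algebra (space P) fst borel) snd z = f (fst z))"

section \<open>Kernel smoothing\<close>

text \<open>
  The kernel enters only through \<open>K (\<parallel>x\<parallel>)\<close>, so \<open>K\<close> is the radial profile and the
  symmetric probability density on \<open>\<real>\<^sup>d\<close> is \<open>x \<mapsto> K (\<parallel>x\<parallel>)\<close>; the type argument
  carries the dimension.
\<close>

definition radial_kernel :: "'d::finite itself \<Rightarrow> (real \<Rightarrow> real) \<Rightarrow> bool" where
  "radial_kernel _ K \<longleftrightarrow>
     (\<lambda>x :: real ^ 'd. K (norm x)) \<in> borel_measurable borel \<and>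
     (\<forall>x :: real ^ 'd. 0 \<le> K (norm x)) \<and>
     (\<integral>\<^sup>+ x. ennreal (K (norm (x :: real ^ 'd))) \<partial>lborel) = 1 \<and>
     compact (closure {x :: real ^ 'd. K (norm x) \<noteq> 0})"

definition smoothed_density ::
  "(real \<Rightarrow> real) \<Rightarrow> real \<Rightarrow> (real ^ 'd::finite) measure \<Rightarrow> real ^ 'd \<Rightarrow> real" where
  "smoothed_density K \<sigma> \<mu> x = (\<integral>u. (1 / \<sigma> ^ CARD('d)) * K (norm (x - u) / \<sigma>) \<partial>\<mu>)"

text \<open>The unlabeled point \<open>X\<^bsub>n+i\<^esub>\<close> is written \<open>u i\<close>, for \<open>1 \<le> i \<le> m\<close>.\<close>

definition density_estimate ::
  "(real \<Rightarrow> real) \<Rightarrow> real \<Rightarrow> nat \<Rightarrow> (nat \<Rightarrow> real ^ 'd::finite) \<Rightarrow> real ^ 'd \<Rightarrow> real" where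
  "density_estimate K \<sigma> m u x =
     (1 / real m) * (\<Sum>i = 1..m. (1 / \<sigma> ^ CARD('d)) * K (norm (x - u i) / \<sigma>))"

definition sup_norm :: "('a \<Rightarrow> real) \<Rightarrow> ennreal" where
  "sup_norm g = (SUP x. ennreal \<bar>g x\<bar>)"

section \<open>The density-sensitive metric\<close>

text \<open>Length of the restriction of a curve to \<open>[a, b]\<close>: the supremum over inscribed polygons.\<close>

definition curve_length :: "(real \<Rightarrow> 'a::metric_space) \<Rightarrow> real \<Rightarrow> real \<Rightarrow> ennreal" where
  "curve_length \<gamma> a b =
     (SUP ts \<in> {ts. sorted ts \<and> set ts \<subseteq> {a..b}}.
        ennreal (\<Sum>i < length ts - 1. dist (\<gamma> (ts ! i)) (\<gamma> (ts ! Suc i))))"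

text \<open>
  A curve is a pair \<open>(l, \<gamma>)\<close> with \<open>\<gamma>\<close> considered on \<open>[0, l]\<close>. Unit speed everywhere means
  that \<open>\<gamma>\<close> is parametrized by arc length; in particular its length is \<open>l\<close>. Curves with
  corners are allowed.
\<close>

definition unit_speed_curves ::
  "real ^ 'd::finite \<Rightarrow> real ^ 'd \<Rightarrow> (real \<times> (real \<Rightarrow> real ^ 'd)) set" where
  "unit_speed_curves x y =
     {(l, \<gamma>). 0 \<le> l \<and> continuous_on {0..l} \<gamma> \<and> \<gamma> 0 = x \<and> \<gamma> l = y \<and>
        (\<forall>s t. 0 \<le> s \<and> s \<le> t \<and> t \<le> l \<longrightarrow> curve_length \<gamma> s t = ennreal (t - s))}"

definition density_metric ::
  "real \<Rightarrow> (real ^ 'd::finite \<Rightarrow> real) \<Rightarrow> real ^ 'd \<Rightarrow> real ^ 'd \<Rightarrow> real" where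
  "density_metric \<alpha> p x y =
     (INF (l, \<gamma>) \<in> unit_speed_curves x y. (LINT t:{0..l}|lborel. exp (- \<alpha> * p (\<gamma> t))))"

definition D_pop ::
  "(real \<Rightarrow> real) \<Rightarrow> ((real ^ 'd::finite) \<times> real) measure \<Rightarrow> real \<Rightarrow> real \<Rightarrow> real ^ 'd \<Rightarrow> real ^ 'd \<Rightarrow> real" where
  "D_pop K P \<alpha> \<sigma> = density_metric \<alpha> (smoothed_density K \<sigma> (X_marginal P))"

definition D_hat ::
  "(real \<Rightarrow> real) \<Rightarrow> nat \<Rightarrow> (nat \<Rightarrow> real ^ 'd::finite) \<Rightarrow> real \<Rightarrow> real \<Rightarrow> real ^ 'd \<Rightarrow> real ^ 'd \<Rightarrow> real" where
  "D_hat K m u \<alpha> \<sigma> = density_metric \<alpha> (density_estimate K \<sigma> m u)"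

definition P_class ::
  "(real \<Rightarrow> real) \<Rightarrow> real \<Rightarrow> real \<Rightarrow> real \<Rightarrow> ((real ^ 'd::finite) \<times> real) measure set" where
  "P_class K \<alpha> \<sigma> L =
     {P. prob_space P \<and> sets P = sets borel \<and>
         measure (X_marginal P) unit_cube = 1 \<and>
         (\<exists>f. regression_version P f \<and>
              (\<forall>x1 \<in> unit_cube. \<forall>x2 \<in> unit_cube. \<bar>f x1 - f x2\<bar> \<le> L * D_pop K P \<alpha> \<sigma> x1 x2))}"

text \<open>
  The centres of the covering balls are not restricted. For \<open>\<epsilon> > 0\<close> finite covers exist, since
  the support is compact and the metric is dominated by the Euclidean distance.
\<close>

definition covering_number ::
  "(real \<Rightarrow> real) \<Rightarrow> ((real ^ 'd::finite) \<times> real) measure \<Rightarrow> real \<Rightarrow> real \<Rightarrow> real \<Rightarrow> nat" where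
  "covering_number K P \<alpha> \<sigma> \<epsilon> =
     (LEAST k. \<exists>C. finite C \<and> card C = k \<and>
        measure_support (X_marginal P) \<subseteq> (\<Union>x \<in> C. {z. D_pop K P \<alpha> \<sigma> x z \<le> \<epsilon>}))"

section \<open>The estimator, the data and the risk\<close>

definition Q_ball :: "real \<Rightarrow> real" where
  "Q_ball x = (if \<bar>x\<bar> \<le> 1 then 1 else 0)"

definition Q_scaled :: "nat \<Rightarrow> real \<Rightarrow> real \<Rightarrow> real" where
  "Q_scaled d h x = (1 / h ^ d) * Q_ball (x / h)"

text \<open>The labeled data are \<open>z i = (X\<^sub>i, Y\<^sub>i)\<close>. The convention \<open>0 / 0 = 0\<close> is that of HOL.\<close>

definition f_hat ::
  "(real \<Rightarrow> real) \<Rightarrow> nat \<Rightarrow> nat \<Rightarrow> real \<Rightarrow> real \<Rightarrow> real \<Rightarrow>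
   (nat \<Rightarrow> (real ^ 'd::finite) \<times> real) \<Rightarrow> (nat \<Rightarrow> real ^ 'd) \<Rightarrow> real ^ 'd \<Rightarrow> real" where
  "f_hat K n m h \<alpha> \<sigma> z u x =
     (\<Sum>i = 1..n. snd (z i) * Q_scaled CARD('d) h (D_hat K m u \<alpha> \<sigma> x (fst (z i)))) /
     (\<Sum>i = 1..n. Q_scaled CARD('d) h (D_hat K m u \<alpha> \<sigma> x (fst (z i))))"

definition labeled_law ::
  "((real ^ 'd::finite) \<times> real) measure \<Rightarrow> nat \<Rightarrow> (nat \<Rightarrow> (real ^ 'd) \<times> real) measure" where
  "labeled_law P n = (\<Pi>\<^sub>M i \<in> {1..n}. P)"

definition unlabeled_law ::
  "((real ^ 'd::finite) \<times> real) measure \<Rightarrow> nat \<Rightarrow> (nat \<Rightarrow> real ^ 'd) measure" where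
  "unlabeled_law P m = (\<Pi>\<^sub>M i \<in> {1..m}. X_marginal P)"

definition good_event ::
  "(real \<Rightarrow> real) \<Rightarrow> real \<Rightarrow> ((real ^ 'd::finite) \<times> real) measure \<Rightarrow> nat \<Rightarrow> real \<Rightarrow> (nat \<Rightarrow> real ^ 'd) set" where
  "good_event K \<sigma> P m \<epsilon> =
     {u \<in> space (unlabeled_law P m).
        sup_norm (\<lambda>x. density_estimate K \<sigma> m u x - smoothed_density K \<sigma> (X_marginal P) x) \<le> ennreal \<epsilon>}"

text \<open>
  The risk of an estimator \<open>g\<close> (a function of the labeled data, the unlabeled data and the point
  \<open>x\<close>), where \<open>f\<close> is a version of the regression function; the value does not depend on the
  version. As an infimum over curves, the metric estimate need only be measurable with respect
  to the completed law of the data; on such integrands the nonnegative integral over the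
  uncompleted law, being a supremum over simple functions below the integrand, has the same value.
\<close>

definition risk ::
  "((real ^ 'd::finite) \<times> real) measure \<Rightarrow> (real ^ 'd \<Rightarrow> real) \<Rightarrow> nat \<Rightarrow> nat \<Rightarrow>
   ((nat \<Rightarrow> (real ^ 'd) \<times> real) \<Rightarrow> (nat \<Rightarrow> real ^ 'd) \<Rightarrow> real ^ 'd \<Rightarrow> real) \<Rightarrow> ennreal" where
  "risk P f n m g =
     (\<integral>\<^sup>+ (z, u). (\<integral>\<^sup>+ x. ennreal ((g z u x - f x)\<^sup>2) \<partial>X_marginal P)
        \<partial>(labeled_law P n \<Otimes>\<^sub>M unlabeled_law P m))"

end

theory Submission
  imports Defs
begin

text \<open>
  For fixed unlabeled data the estimator is an average of the responses over the window
  \<open>{y. D_hat x y \<le> h}\<close> around \<open>x\<close>, and the unlabeled data are independent of the labeled data. The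
  proof splits according to whether the density estimate is uniformly \<open>\<epsilon>\<close>-accurate. If it is not,
  which has probability at most \<open>1 / m\<close>, the squared error is at most \<open>(2 M)\<^sup>2\<close>; this is the last term
  of the bound.

  If it is, the weights along any curve change by at most the factor \<open>exp (\<alpha> \<epsilon>)\<close>, and so do the
  metrics (\<open>density_metric_perturb\<close>). Every point of the window then has population distance at most
  \<open>h exp (\<alpha> \<epsilon>)\<close> to \<open>x\<close>, which by the Lipschitz condition bounds the bias by \<open>L h exp (\<alpha> \<epsilon>)\<close>. The
  residuals are uncorrelated given the covariates, so the variance is at most \<open>M\<^sup>2 / S\<close>, where \<open>S\<close> is
  the number of covariates in the window; an empty window costs at most \<open>M\<^sup>2\<close>. The two together are at
  most \<open>M\<^sup>2 / max 1 S\<close> (\<open>local_average_squared_error\<close>). Since \<open>S\<close> is binomial with success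
  probability \<open>q\<close>, the mass of the window, and \<open>1 / max 1 S \<le> 2 / (S + 1)\<close>, the mean is at most
  \<open>2 M\<^sup>2 / ((n + 1) q)\<close> (\<open>local_average_risk\<close>).

  It remains to integrate \<open>1 / q\<close> over \<open>x\<close>. The window around \<open>x\<close> contains each ball of radius
  \<open>exp (- \<epsilon> \<alpha>) h / 2\<close> to which \<open>x\<close> belongs, by the triangle inequality for the population metric. On
  such a ball \<open>1 / q\<close> is at most the inverse of its mass, so each ball of a minimal cover contributes
  at most \<open>1\<close> (\<open>nn_integral_inverse_cell_mass_le\<close>), and the covering number appears.

  Two measure-theoretic points need care. The metrics are infima over uncountably many curves, but
  as pseudometrics below the Euclidean metric they are continuous, so for fixed unlabeled data all
  integrands are measurable. In the unlabeled data measurability may fail; there the risk is a lower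
  integral, and the inequality \<open>nn_integral_pair_le_iterated\<close>, valid for all functions, takes the
  place of Tonelli's theorem.
\<close>

section \<open>Arc length and unit speed curves\<close>

definition inscribed_length :: "(real \<Rightarrow> 'a::metric_space) \<Rightarrow> real list \<Rightarrow> real" where
  "inscribed_length \<gamma> ts = (\<Sum>i < length ts - 1. dist (\<gamma> (ts ! i)) (\<gamma> (ts ! Suc i)))"

lemma inscribed_length_simps [simp]:
  "inscribed_length \<gamma> [] = 0"
  "inscribed_length \<gamma> [s] = 0"
  "inscribed_length \<gamma> (s # t # ts) = dist (\<gamma> s) (\<gamma> t) + inscribed_length \<gamma> (t # ts)"
  by (simp_all add: inscribed_length_def sum.lessThan_Suc_shift del: sum.lessThan_Suc)

lemma inscribed_length_map:
  "inscribed_length \<gamma> (map \<phi> ts) = inscribed_length (\<gamma> \<circ> \<phi>) ts"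
  by (simp add: inscribed_length_def)

lemma inscribed_length_cong:
  assumes "\<And>t. t \<in> set ts \<Longrightarrow> \<gamma> t = \<delta> t"
  shows "inscribed_length \<gamma> ts = inscribed_length \<delta> ts"
  unfolding inscribed_length_def using assms by (intro sum.cong) auto

lemma inscribed_length_append:
  "inscribed_length \<gamma> ts + inscribed_length \<gamma> us \<le> inscribed_length \<gamma> (ts @ us)"
proof (induction ts rule: induct_list012)
  case (2 s)
  show ?case by (cases us) simp_all
qed simp_all

lemma inscribed_length_snoc:
  "inscribed_length \<gamma> (ts @ [s, t]) = inscribed_length \<gamma> (ts @ [s]) + dist (\<gamma> s) (\<gamma> t)"
  by (induction ts rule: induct_list012) simp_all

lemma inscribed_length_rev: "inscribed_length \<gamma> (rev ts) = inscribed_length \<gamma> ts"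
  by (induction ts rule: induct_list012) (simp_all add: inscribed_length_snoc dist_commute)

lemma inscribed_length_le_nonexpansive:
  assumes "sorted ts" "set ts \<subseteq> {a..b}" "a \<le> b"
    and lip: "\<And>s t. a \<le> s \<Longrightarrow> s \<le> t \<Longrightarrow> t \<le> b \<Longrightarrow> dist (\<gamma> s) (\<gamma> t) \<le> t - s"
  shows "inscribed_length \<gamma> ts \<le> b - a"
  using assms(1-3) lip
proof (induction ts arbitrary: a rule: induct_list012)
  case (3 s t ts)
  have "inscribed_length \<gamma> (t # ts) \<le> b - t"
    using 3 by (intro "3.IH"(2)) auto
  moreover have "dist (\<gamma> s) (\<gamma> t) \<le> t - s"
    using 3 by (intro "3.prems"(4)) auto
  moreover have "a \<le> s" using 3 by simp
  ultimately show ?case by simp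
qed simp_all

lemma curve_length_eq:
  "curve_length \<gamma> a b = (SUP ts \<in> {ts. sorted ts \<and> set ts \<subseteq> {a..b}}. ennreal (inscribed_length \<gamma> ts))"
  by (simp add: curve_length_def inscribed_length_def)

lemma inscribed_length_le_curve_length:
  "sorted ts \<Longrightarrow> set ts \<subseteq> {a..b} \<Longrightarrow> ennreal (inscribed_length \<gamma> ts) \<le> curve_length \<gamma> a b"
  unfolding curve_length_eq by (intro SUP_upper) auto

lemma inscribed_length_nonneg: "0 \<le> inscribed_length \<gamma> ts"
  by (simp add: inscribed_length_def sum_nonneg)

text \<open>
  Polygons inscribed in the two parts concatenate to one inscribed in the whole. For joined curves
  this is the lower bound on the length; the upper bound will come from nonexpansiveness.
\<close>

lemma curve_length_superadditive:
  assumes "a \<le> c" "c \<le> b"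
  shows "curve_length \<gamma> a c + curve_length \<gamma> c b \<le> curve_length \<gamma> a b"
proof -
  let ?S = "\<lambda>a b. {ts::real list. sorted ts \<and> set ts \<subseteq> {a..b}}"
  have ne: "?S a b \<noteq> {}" for a b by (auto intro: exI[of _ "[]"])
  have 1: "ennreal (inscribed_length \<gamma> ts) + ennreal (inscribed_length \<gamma> us) \<le> curve_length \<gamma> a b"
    if "ts \<in> ?S a c" "us \<in> ?S c b" for ts us
  proof -
    have "ennreal (inscribed_length \<gamma> ts) + ennreal (inscribed_length \<gamma> us)
        \<le> ennreal (inscribed_length \<gamma> (ts @ us))"
      using inscribed_length_append[of \<gamma> ts us]
      by (simp add: ennreal_plus[symmetric] inscribed_length_nonneg del: ennreal_plus)
    also have "\<dots> \<le> curve_length \<gamma> a b"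
      using that assms by (intro inscribed_length_le_curve_length) (auto simp: sorted_append, fastforce+)
    finally show ?thesis .
  qed
  have "curve_length \<gamma> a c + ennreal (inscribed_length \<gamma> us) \<le> curve_length \<gamma> a b"
    if "us \<in> ?S c b" for us
    unfolding curve_length_eq[of \<gamma> a c]
    by (subst ennreal_SUP_add_left[symmetric]) (use ne[of a c] 1 that in \<open>auto intro!: SUP_least simp del: ennreal_plus\<close>)
  then show ?thesis
    using ne[of c b] ennreal_SUP_add_right[OF ne[of c b], of "curve_length \<gamma> a c"]
    by (auto simp: curve_length_eq[of \<gamma> c b] intro!: SUP_least simp del: ennreal_plus)
qed

lemma curve_length_mono_map:
  assumes "\<And>ts. sorted ts \<Longrightarrow> set ts \<subseteq> {a..b} \<Longrightarrow>
    \<exists>us. sorted us \<and> set us \<subseteq> {a'..b'} \<and> inscribed_length \<gamma> ts \<le> inscribed_length \<delta> us"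
  shows "curve_length \<gamma> a b \<le> curve_length \<delta> a' b'"
  unfolding curve_length_eq
  using assms by (intro SUP_mono) (metis (mono_tags, lifting) ennreal_leI mem_Collect_eq)

lemma curve_length_nonexpansive:
  assumes "a \<le> b" "\<And>s t. a \<le> s \<Longrightarrow> s \<le> t \<Longrightarrow> t \<le> b \<Longrightarrow> dist (\<gamma> s) (\<gamma> t) \<le> t - s"
  shows "curve_length \<gamma> a b \<le> ennreal (b - a)"
  unfolding curve_length_eq
  using assms by (intro SUP_least ennreal_leI inscribed_length_le_nonexpansive) auto

lemma unit_speed_nonexpansive:
  assumes "(l, \<gamma>) \<in> unit_speed_curves x y" "0 \<le> s" "s \<le> t" "t \<le> l"
  shows "dist (\<gamma> s) (\<gamma> t) \<le> t - s"
proof -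
  have "ennreal (dist (\<gamma> s) (\<gamma> t)) \<le> curve_length \<gamma> s t"
    using inscribed_length_le_curve_length[of "[s, t]" s t \<gamma>] assms by simp
  also have "\<dots> = ennreal (t - s)"
    using assms by (auto simp: unit_speed_curves_def)
  finally show ?thesis using assms by simp
qed

text \<open>
  For a nonexpansive curve the inscribed polygons telescope to at most \<open>t - s\<close>, so unit speed only
  has to be checked from below; continuity comes for free.
\<close>

lemma unit_speed_curvesI:
  assumes "0 \<le> l" "\<gamma> 0 = x" "\<gamma> l = y"
    and lip: "\<And>s t. 0 \<le> s \<Longrightarrow> s \<le> t \<Longrightarrow> t \<le> l \<Longrightarrow> dist (\<gamma> s) (\<gamma> t) \<le> t - s"
    and len: "\<And>s t. 0 \<le> s \<Longrightarrow> s \<le> t \<Longrightarrow> t \<le> l \<Longrightarrow> ennreal (t - s) \<le> curve_length \<gamma> s t"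
  shows "(l, \<gamma>) \<in> unit_speed_curves x y"
proof -
  have "1-lipschitz_on {0..l} \<gamma>"
  proof (rule lipschitz_onI)
    fix s t assume "s \<in> {0..l}" "t \<in> {0..l}"
    then show "dist (\<gamma> s) (\<gamma> t) \<le> 1 * dist s t"
      using lip[of s t] lip[of t s] by (cases "s \<le> t") (auto simp: dist_real_def dist_commute)
  qed simp
  then have "continuous_on {0..l} \<gamma>" by (rule lipschitz_on_continuous_on)
  moreover have "curve_length \<gamma> s t = ennreal (t - s)" if "0 \<le> s" "s \<le> t" "t \<le> l" for s t
    using that by (intro antisym len curve_length_nonexpansive lip) auto
  ultimately show ?thesis
    using assms by (auto simp: unit_speed_curves_def)
qed

lemma unit_speed_length:
  assumes "(l, \<gamma>) \<in> unit_speed_curves x y" "0 \<le> s" "s \<le> t" "t \<le> l"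
  shows "curve_length \<gamma> s t = ennreal (t - s)"
  using assms by (auto simp: unit_speed_curves_def)

text \<open>
  The direction is \<open>sgn (y - x)\<close>, which is \<open>0\<close> if \<open>x = y\<close>, so that the constant curve of length \<open>0\<close>
  is covered by the same formula.
\<close>

lemma unit_speed_segment:
  fixes x y :: "real ^ 'd::finite"
  shows "(dist x y, \<lambda>t. x + t *\<^sub>R sgn (y - x)) \<in> unit_speed_curves x y"
proof (rule unit_speed_curvesI)
  let ?\<gamma> = "\<lambda>t. x + t *\<^sub>R sgn (y - x)"
  have eq: "dist (?\<gamma> s) (?\<gamma> t) = t - s" if "0 \<le> s" "s \<le> t" "t \<le> dist x y" for s t
  proof (cases "x = y")
    case False
    have "dist (?\<gamma> s) (?\<gamma> t) = norm ((s - t) *\<^sub>R sgn (y - x))"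
      by (simp add: dist_norm algebra_simps)
    also have "\<dots> = t - s" using False that by (simp add: norm_sgn)
    finally show ?thesis .
  qed (use that in auto)
  show "?\<gamma> (dist x y) = y"
    by (cases "x = y") (simp_all add: sgn_div_norm dist_norm norm_minus_commute)
  show "dist (?\<gamma> s) (?\<gamma> t) \<le> t - s" if "0 \<le> s" "s \<le> t" "t \<le> dist x y" for s t
    using eq[OF that] by simp
  show "ennreal (t - s) \<le> curve_length ?\<gamma> s t" if "0 \<le> s" "s \<le> t" "t \<le> dist x y" for s t
    using inscribed_length_le_curve_length[of "[s, t]" s t ?\<gamma>] eq[OF that] that
    by (simp del: dist_add_cancel)
qed simp_all

lemma unit_speed_reverse:
  assumes c: "(l, \<gamma>) \<in> unit_speed_curves x y"
  shows "(l, \<lambda>t. \<gamma> (l - t)) \<in> unit_speed_curves y x"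
proof (rule unit_speed_curvesI)
  show "0 \<le> l" "\<gamma> (l - 0) = y" "\<gamma> (l - l) = x"
    using c by (auto simp: unit_speed_curves_def)
  show "dist (\<gamma> (l - s)) (\<gamma> (l - t)) \<le> t - s" if "0 \<le> s" "s \<le> t" "t \<le> l" for s t
    using unit_speed_nonexpansive[OF c, of "l - t" "l - s"] that by (simp add: dist_commute)
  show "ennreal (t - s) \<le> curve_length (\<lambda>t. \<gamma> (l - t)) s t" if "0 \<le> s" "s \<le> t" "t \<le> l" for s t
  proof -
    have "curve_length \<gamma> (l - t) (l - s) \<le> curve_length (\<lambda>t. \<gamma> (l - t)) s t"
    proof (rule curve_length_mono_map)
      fix ts assume ts: "sorted ts" "set ts \<subseteq> {l - t..l - s}"
      let ?us = "rev (map ((-) l) ts)"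
      have "sorted ?us"
        using ts by (auto simp: sorted_wrt_rev sorted_wrt_map elim: sorted_wrt_mono_rel[rotated])
      moreover have "set ?us \<subseteq> {s..t}" using ts by auto
      moreover have "inscribed_length (\<lambda>t. \<gamma> (l - t)) ?us = inscribed_length \<gamma> ts"
        by (simp only: inscribed_length_rev inscribed_length_map o_def) simp
      ultimately show "\<exists>us. sorted us \<and> set us \<subseteq> {s..t} \<and>
          inscribed_length \<gamma> ts \<le> inscribed_length (\<lambda>t. \<gamma> (l - t)) us"
        by (intro exI[of _ ?us]) simp
    qed
    then show ?thesis using unit_speed_length[OF c, of "l - t" "l - s"] that by simp
  qed
qed

definition join_curves :: "real \<Rightarrow> (real \<Rightarrow> 'a) \<Rightarrow> (real \<Rightarrow> 'a) \<Rightarrow> real \<Rightarrow> 'a" where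
  "join_curves l \<gamma> \<delta> t = (if t \<le> l then \<gamma> t else \<delta> (t - l))"

text \<open>
  A piece of the joined curve that lies on one side of the junction inherits its length from the
  given curves. For a piece that straddles the junction, superadditivity of the length gives the
  lower bound, which by the introduction rule is all that is needed.
\<close>

lemma unit_speed_join:
  assumes c: "(l, \<gamma>) \<in> unit_speed_curves x y" and d: "(k, \<delta>) \<in> unit_speed_curves y z"
  shows "(l + k, join_curves l \<gamma> \<delta>) \<in> unit_speed_curves x z"
proof (rule unit_speed_curvesI)
  let ?j = "join_curves l \<gamma> \<delta>"
  have l: "0 \<le> l" "\<gamma> 0 = x" "\<gamma> l = y" and k: "0 \<le> k" "\<delta> 0 = y" "\<delta> k = z"
    using c d by (auto simp: unit_speed_curves_def)
  have j1: "?j t = \<gamma> t" if "t \<le> l" for t using that by (simp add: join_curves_def)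
  have j2: "?j t = \<delta> (t - l)" if "l \<le> t" for t using that l k by (auto simp: join_curves_def)
  show "0 \<le> l + k" "?j 0 = x" "?j (l + k) = z" using l k j1[of 0] j2[of "l + k"] by simp_all
  have lip1: "dist (?j s) (?j t) \<le> t - s" if "0 \<le> s" "s \<le> t" "t \<le> l" for s t
    using unit_speed_nonexpansive[OF c that] that by (simp add: j1)
  have lip2: "dist (?j s) (?j t) \<le> t - s" if "l \<le> s" "s \<le> t" "t \<le> l + k" for s t
    using unit_speed_nonexpansive[OF d, of "s - l" "t - l"] that by (simp add: j2)
  show "dist (?j s) (?j t) \<le> t - s" if "0 \<le> s" "s \<le> t" "t \<le> l + k" for s t
    using lip1[of s t] lip2[of s t] lip1[of s l] lip2[of l t] dist_triangle[of "?j s" "?j t" "?j l"] that l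
    by (cases "t \<le> l"; cases "l \<le> s") auto
  have len1: "ennreal (t - s) \<le> curve_length ?j s t" if "0 \<le> s" "s \<le> t" "t \<le> l" for s t
  proof -
    have "curve_length \<gamma> s t \<le> curve_length ?j s t"
    proof (rule curve_length_mono_map)
      fix ts assume ts: "sorted ts" "set ts \<subseteq> {s..t}"
      then have "inscribed_length \<gamma> ts = inscribed_length ?j ts"
        using that by (intro inscribed_length_cong) (force simp: j1)
      then show "\<exists>us. sorted us \<and> set us \<subseteq> {s..t} \<and> inscribed_length \<gamma> ts \<le> inscribed_length ?j us"
        using ts by (intro exI[of _ ts]) simp
    qed
    then show ?thesis using unit_speed_length[OF c that] by simp
  qed
  have len2: "ennreal (t - s) \<le> curve_length ?j s t" if "l \<le> s" "s \<le> t" "t \<le> l + k" for s t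
  proof -
    have "curve_length \<delta> (s - l) (t - l) \<le> curve_length ?j s t"
    proof (rule curve_length_mono_map)
      fix ts assume ts: "sorted ts" "set ts \<subseteq> {s - l..t - l}"
      let ?us = "map ((+) l) ts"
      have "inscribed_length \<delta> ts = inscribed_length (?j \<circ> (+) l) ts"
        using that ts by (intro inscribed_length_cong) (force simp: j2)
      moreover have "sorted ?us"
        using ts by (auto simp: sorted_wrt_map)
      moreover have "set ?us \<subseteq> {s..t}" using ts by force
      ultimately show "\<exists>us. sorted us \<and> set us \<subseteq> {s..t} \<and> inscribed_length \<delta> ts \<le> inscribed_length ?j us"
        by (intro exI[of _ ?us]) (simp add: inscribed_length_map)
    qed
    then show ?thesis using unit_speed_length[OF d, of "s - l" "t - l"] that by simp
  qed
  show "ennreal (t - s) \<le> curve_length ?j s t" if "0 \<le> s" "s \<le> t" "t \<le> l + k" for s t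
  proof -
    consider "t \<le> l" | "l \<le> s" | "s \<le> l" "l \<le> t" by linarith
    then show ?thesis
    proof cases
      case 3
      have "ennreal (t - s) = ennreal (l - s) + ennreal (t - l)"
        using 3 by (simp add: ennreal_plus[symmetric] del: ennreal_plus)
      also have "\<dots> \<le> curve_length ?j s l + curve_length ?j l t"
        using 3 that by (intro add_mono len1 len2) auto
      also have "\<dots> \<le> curve_length ?j s t"
        using 3 by (rule curve_length_superadditive)
      finally show ?thesis .
    qed (use len1 len2 that in auto)
  qed
qed

section \<open>The density-sensitive metric\<close>

definition curve_cost :: "real \<Rightarrow> ('a \<Rightarrow> real) \<Rightarrow> real \<Rightarrow> (real \<Rightarrow> 'a) \<Rightarrow> real" where
  "curve_cost \<alpha> p l \<gamma> = (LINT t:{0..l}|lborel. exp (- \<alpha> * p (\<gamma> t)))"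

lemma density_metric_eq:
  "density_metric \<alpha> p x y = (INF (l, \<gamma>) \<in> unit_speed_curves x y. curve_cost \<alpha> p l \<gamma>)"
  by (simp add: density_metric_def curve_cost_def)

text \<open>
  For a nonnegative measurable weight the infimum over curves is a pseudometric: curves can be
  joined and reversed, and costs add up accordingly. It lies below the Euclidean metric, since
  straight segments are among the curves.
\<close>

context
  fixes \<alpha> :: real and p :: "real ^ 'd::finite \<Rightarrow> real"
  assumes alpha: "0 \<le> \<alpha>"
    and p_measurable [measurable]: "p \<in> borel_measurable borel"
    and p_nonneg: "\<And>x. 0 \<le> p x"
begin

text \<open>
  The weight \<open>exp (- \<alpha> p)\<close> lies in \<open>(0, 1]\<close>. Integrability matters beyond bookkeeping: the Bochner
  integral of a function that is not integrable is \<open>0\<close>, and a single curve of this kind would make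
  the infimum collapse.
\<close>

lemma curve_integrand_integrable:
  assumes "(l, \<gamma>) \<in> unit_speed_curves x y"
  shows "set_integrable lborel {0..l} (\<lambda>t. exp (- \<alpha> * p (\<gamma> t)))"
proof -
  \<comment> \<open>The curve is known to be continuous on \<open>{0..l}\<close> only, so it is cut
    off outside to get measurability.\<close>
  have "continuous_on {0..l} \<gamma>"
    using assms by (simp add: unit_speed_curves_def)
  then have [measurable]: "(\<lambda>t. indicator {0..l} t *\<^sub>R \<gamma> t) \<in> borel_measurable borel"
    by (intro borel_measurable_continuous_on_indicator) auto
  have "(\<lambda>t. indicator {0..l} t *\<^sub>R exp (- \<alpha> * p (indicator {0..l} t *\<^sub>R \<gamma> t))) \<in> borel_measurable borel"
    by measurable
  also have "(\<lambda>t. indicator {0..l} t *\<^sub>R exp (- \<alpha> * p (indicator {0..l} t *\<^sub>R \<gamma> t)))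
      = (\<lambda>t. indicator {0..l} t *\<^sub>R exp (- \<alpha> * p (\<gamma> t)))"
    by (auto simp: indicator_def)
  finally have "(\<lambda>t. indicator {0..l} t *\<^sub>R exp (- \<alpha> * p (\<gamma> t))) \<in> borel_measurable borel" .
  then show ?thesis
    unfolding set_integrable_def
    by (intro integrableI_bounded_set[where A = "{0..l}" and B = 1])
      (auto simp: alpha p_nonneg emeasure_lborel_Icc_eq)
qed

lemma curve_cost_nonneg: "0 \<le> curve_cost \<alpha> p l \<gamma>"
  unfolding curve_cost_def set_lebesgue_integral_def by (intro integral_nonneg_AE) auto

lemma curve_cost_le_length:
  assumes c: "(l, \<gamma>) \<in> unit_speed_curves x y"
  shows "curve_cost \<alpha> p l \<gamma> \<le> l"
proof -
  have "curve_cost \<alpha> p l \<gamma> \<le> (LINT t:{0..l}|lborel. 1)"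
    unfolding curve_cost_def
    by (intro set_integral_mono curve_integrand_integrable[OF c])
      (auto simp: alpha p_nonneg set_integrable_def
        intro!: integrable_real_indicator emeasure_lborel_Icc_eq[THEN ord_eq_less_trans])
  also have "\<dots> = l"
    using c by (simp add: unit_speed_curves_def set_lebesgue_integral_def)
  finally show ?thesis .
qed

lemma curve_cost_reverse:
  "curve_cost \<alpha> p l (\<lambda>t. \<gamma> (l - t)) = curve_cost \<alpha> p l \<gamma>"
proof -
  have "curve_cost \<alpha> p l \<gamma>
      = (\<integral>t. indicator {0..l} (l + (-1) * t) *\<^sub>R exp (- \<alpha> * p (\<gamma> (l + (-1) * t))) \<partial>lborel)"
    unfolding curve_cost_def set_lebesgue_integral_def
    by (subst lborel_integral_real_affine[where c = "-1" and t = l]) simp_all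
  also have "\<dots> = curve_cost \<alpha> p l (\<lambda>t. \<gamma> (l - t))"
    unfolding curve_cost_def set_lebesgue_integral_def
    by (intro Bochner_Integration.integral_cong) (auto simp: indicator_def)
  finally show ?thesis by simp
qed

lemma curve_cost_join:
  assumes c: "(l, \<gamma>) \<in> unit_speed_curves x y" and d: "(k, \<delta>) \<in> unit_speed_curves y z"
  shows "curve_cost \<alpha> p (l + k) (join_curves l \<gamma> \<delta>) = curve_cost \<alpha> p l \<gamma> + curve_cost \<alpha> p k \<delta>"
proof -
  let ?w = "\<lambda>\<gamma> t. exp (- \<alpha> * p (\<gamma> t))"
  have l: "0 \<le> l" "0 \<le> k" using c d by (auto simp: unit_speed_curves_def)
  have int1: "integrable lborel (\<lambda>t. indicator {0..l} t *\<^sub>R ?w \<gamma> t)"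
    using curve_integrand_integrable[OF c] by (simp add: set_integrable_def)
  have int2: "integrable lborel (\<lambda>t. indicator {0..k} t *\<^sub>R ?w \<delta> t)"
    using curve_integrand_integrable[OF d] by (simp add: set_integrable_def)
  have int2': "integrable lborel (\<lambda>t. indicator {0..k} (- l + 1 * t) *\<^sub>R ?w \<delta> (- l + 1 * t))"
    using lborel_integrable_real_affine[OF int2, of 1 "- l"] by simp
  have int: "integrable lborel (\<lambda>t. indicator {0..l + k} t *\<^sub>R ?w (join_curves l \<gamma> \<delta>) t)"
    using curve_integrand_integrable[OF unit_speed_join[OF c d]] by (simp add: set_integrable_def)
  have "curve_cost \<alpha> p (l + k) (join_curves l \<gamma> \<delta>)
      = (\<integral>t. indicator {0..l} t *\<^sub>R ?w \<gamma> t
            + indicator {0..k} (- l + 1 * t) *\<^sub>R ?w \<delta> (- l + 1 * t) \<partial>lborel)"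
    unfolding curve_cost_def set_lebesgue_integral_def
  proof (rule integral_cong_AE)
    show "AE t in lborel. indicator {0..l + k} t *\<^sub>R ?w (join_curves l \<gamma> \<delta>) t
        = indicator {0..l} t *\<^sub>R ?w \<gamma> t + indicator {0..k} (- l + 1 * t) *\<^sub>R ?w \<delta> (- l + 1 * t)"
      using AE_lborel_singleton[of l]
      by eventually_elim (use l in \<open>auto simp: indicator_def join_curves_def algebra_simps\<close>)
  qed (intro borel_measurable_integrable int Bochner_Integration.integrable_add int1 int2')+
  also have "\<dots> = curve_cost \<alpha> p l \<gamma> + curve_cost \<alpha> p k \<delta>"
    unfolding curve_cost_def set_lebesgue_integral_def
    by (subst Bochner_Integration.integral_add[OF int1 int2'],
        subst (3) lborel_integral_real_affine[where c = 1 and t = "- l"]) simp_all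
  finally show ?thesis .
qed

lemma density_metric_le_cost:
  "(l, \<gamma>) \<in> unit_speed_curves x y \<Longrightarrow> density_metric \<alpha> p x y \<le> curve_cost \<alpha> p l \<gamma>"
  unfolding density_metric_eq
  by (rule cINF_lower2) (auto intro!: bdd_belowI2[where m = 0] simp: curve_cost_nonneg)

lemma le_density_metric:
  assumes "\<And>l \<gamma>. (l, \<gamma>) \<in> unit_speed_curves x y \<Longrightarrow> b \<le> curve_cost \<alpha> p l \<gamma>"
  shows "b \<le> density_metric \<alpha> p x y"
  unfolding density_metric_eq
  by (rule cINF_greatest) (use assms unit_speed_segment[of x y] in \<open>auto split: prod.split\<close>)

lemma density_metric_nonneg: "0 \<le> density_metric \<alpha> p x y"
  by (intro le_density_metric curve_cost_nonneg)

lemma density_metric_le_dist: "density_metric \<alpha> p x y \<le> dist x y"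
  using density_metric_le_cost[OF unit_speed_segment] curve_cost_le_length[OF unit_speed_segment]
  by (rule order_trans)

lemma density_metric_sym: "density_metric \<alpha> p x y = density_metric \<alpha> p y x"
proof -
  have "density_metric \<alpha> p x y \<le> density_metric \<alpha> p y x" for x y
    by (intro le_density_metric)
      (metis density_metric_le_cost unit_speed_reverse curve_cost_reverse)
  then show ?thesis by (intro antisym)
qed

lemma density_metric_triangle:
  "density_metric \<alpha> p x z \<le> density_metric \<alpha> p x y + density_metric \<alpha> p y z"
proof -
  have "density_metric \<alpha> p x z - curve_cost \<alpha> p k \<delta> \<le> density_metric \<alpha> p x y"
    if d: "(k, \<delta>) \<in> unit_speed_curves y z" for k \<delta>
  proof (rule le_density_metric)
    fix l \<gamma> assume c: "(l, \<gamma>) \<in> unit_speed_curves x y"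
    show "density_metric \<alpha> p x z - curve_cost \<alpha> p k \<delta> \<le> curve_cost \<alpha> p l \<gamma>"
      using density_metric_le_cost[OF unit_speed_join[OF c d]] curve_cost_join[OF c d] by simp
  qed
  then have "density_metric \<alpha> p x z - density_metric \<alpha> p x y \<le> density_metric \<alpha> p y z"
    by (intro le_density_metric) (simp add: algebra_simps)
  then show ?thesis by simp
qed

text \<open>
  A pseudometric below the Euclidean one is Lipschitz in both arguments, hence continuous. This is
  why the metric, although an uncountable infimum, is jointly measurable for fixed data.
\<close>

lemma density_metric_measurable:
  "(\<lambda>(x, y). density_metric \<alpha> p x y) \<in> borel_measurable (borel \<Otimes>\<^sub>M borel)"
proof -
  let ?D = "\<lambda>z. density_metric \<alpha> p (fst z) (snd z)"
  have le: "?D z \<le> ?D z' + 2 * dist z z'" for z z'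
  proof -
    have "?D z \<le> density_metric \<alpha> p (fst z) (fst z') + density_metric \<alpha> p (fst z') (snd z)"
      by (rule density_metric_triangle)
    also have "density_metric \<alpha> p (fst z') (snd z)
        \<le> ?D z' + density_metric \<alpha> p (snd z') (snd z)"
      by (rule density_metric_triangle)
    finally show ?thesis
      using density_metric_le_dist[of "fst z" "fst z'"] density_metric_le_dist[of "snd z'" "snd z"]
        dist_fst_le[of z z'] dist_snd_le[of z z'] by (simp add: dist_commute)
  qed
  have "2-lipschitz_on UNIV ?D"
  proof (rule lipschitz_onI)
    fix z z' show "dist (?D z) (?D z') \<le> 2 * dist z z'"
      using le[of z z'] le[of z' z] by (auto simp: dist_real_def dist_commute abs_le_iff)
  qed simp
  then have "continuous_on UNIV ?D" by (rule lipschitz_on_continuous_on)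
  then have "?D \<in> borel_measurable borel" by (rule borel_measurable_continuous_onI)
  then show ?thesis by (simp add: case_prod_beta' borel_prod)
qed

end

text \<open>
  If \<open>q \<le> p + \<epsilon>\<close>, then \<open>exp (- \<alpha> p) \<le> exp (\<alpha> \<epsilon>) exp (- \<alpha> q)\<close> along every curve. Applied in both
  directions, it makes the estimated and the population metric equivalent up to the factor
  \<open>exp (\<alpha> \<epsilon>)\<close> as soon as the densities are uniformly \<open>\<epsilon>\<close>-close.
\<close>

lemma density_metric_perturb:
  fixes p q :: "real ^ 'd::finite \<Rightarrow> real"
  assumes "0 \<le> \<alpha>" "p \<in> borel_measurable borel" "\<And>x. 0 \<le> p x"
    and "q \<in> borel_measurable borel" "\<And>x. 0 \<le> q x"
    and close: "\<And>x. q x \<le> p x + \<epsilon>"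
  shows "density_metric \<alpha> p x y \<le> exp (\<alpha> * \<epsilon>) * density_metric \<alpha> q x y"
proof -
  note P = assms(1-3) and Q = assms(1,4,5)
  have cost: "curve_cost \<alpha> p l \<gamma> \<le> exp (\<alpha> * \<epsilon>) * curve_cost \<alpha> q l \<gamma>"
    if c: "(l, \<gamma>) \<in> unit_speed_curves x y" for l \<gamma>
  proof -
    have "curve_cost \<alpha> p l \<gamma> \<le> (LINT t:{0..l}|lborel. exp (\<alpha> * \<epsilon>) * exp (- \<alpha> * q (\<gamma> t)))"
      unfolding curve_cost_def
    proof (rule set_integral_mono)
      fix t
      have "\<alpha> * q (\<gamma> t) \<le> \<alpha> * (p (\<gamma> t) + \<epsilon>)"
        using assms(1) close by (rule mult_left_mono[rotated])
      then show "exp (- \<alpha> * p (\<gamma> t)) \<le> exp (\<alpha> * \<epsilon>) * exp (- \<alpha> * q (\<gamma> t))"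
        by (simp add: exp_add[symmetric] algebra_simps)
    qed (use curve_integrand_integrable[OF P c] curve_integrand_integrable[OF Q c] in auto)
    then show ?thesis by (simp add: curve_cost_def)
  qed
  have "exp (- (\<alpha> * \<epsilon>)) * density_metric \<alpha> p x y \<le> density_metric \<alpha> q x y"
  proof (rule le_density_metric[OF Q])
    fix l \<gamma> assume c: "(l, \<gamma>) \<in> unit_speed_curves x y"
    show "exp (- (\<alpha> * \<epsilon>)) * density_metric \<alpha> p x y \<le> curve_cost \<alpha> q l \<gamma>"
      using density_metric_le_cost[OF P c] cost[OF c] by (simp add: exp_minus field_simps)
  qed
  then show ?thesis by (simp add: exp_minus field_simps)
qed

lemma scaled_kernel_measurable:
  assumes K: "radial_kernel TYPE('d::finite) K" and "0 < \<sigma>"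
  shows "(\<lambda>x :: real ^ 'd. K (norm x / \<sigma>)) \<in> borel_measurable borel"
proof -
  have "(\<lambda>x :: real ^ 'd. K (norm ((1 / \<sigma>) *\<^sub>R x))) \<in> borel_measurable borel"
    using K unfolding radial_kernel_def
    by (intro measurable_compose[of "\<lambda>x. (1 / \<sigma>) *\<^sub>R x" borel borel "\<lambda>x. K (norm x)"]) auto
  then show ?thesis using \<open>0 < \<sigma>\<close> by simp
qed

lemma smoothed_density_measurable:
  fixes \<mu> :: "(real ^ 'd::finite) measure"
  assumes K: "radial_kernel TYPE('d) K" and "0 < \<sigma>" and "sigma_finite_measure \<mu>"
    and [measurable_cong]: "sets \<mu> = sets borel"
  shows "smoothed_density K \<sigma> \<mu> \<in> borel_measurable borel"
proof -
  interpret sigma_finite_measure \<mu> by fact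
  note [measurable] = scaled_kernel_measurable[OF K \<open>0 < \<sigma>\<close>]
  show ?thesis
    unfolding smoothed_density_def by measurable
qed

lemma density_estimate_measurable:
  assumes K: "radial_kernel TYPE('d::finite) K" and "0 < \<sigma>"
  shows "density_estimate K \<sigma> m (u :: nat \<Rightarrow> real ^ 'd) \<in> borel_measurable borel"
proof -
  note [measurable] = scaled_kernel_measurable[OF K \<open>0 < \<sigma>\<close>]
  show ?thesis
    unfolding density_estimate_def by measurable
qed

lemma radial_kernel_nonneg:
  assumes K: "radial_kernel TYPE('d::finite) K" and "0 \<le> r"
  shows "0 \<le> K r"
proof -
  obtain x :: "real ^ 'd" where "norm x = r" using vector_choose_size[OF \<open>0 \<le> r\<close>] by blast
  then show ?thesis using K by (auto simp: radial_kernel_def)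
qed

lemma smoothed_density_nonneg:
  assumes "radial_kernel TYPE('d::finite) K" and "0 < \<sigma>"
  shows "0 \<le> smoothed_density K \<sigma> \<mu> (x :: real ^ 'd)"
  unfolding smoothed_density_def using assms radial_kernel_nonneg[OF assms(1)]
  by (intro integral_nonneg_AE) auto

lemma density_estimate_nonneg:
  assumes "radial_kernel TYPE('d::finite) K" and "0 < \<sigma>"
  shows "0 \<le> density_estimate K \<sigma> m u (x :: real ^ 'd)"
  unfolding density_estimate_def using assms radial_kernel_nonneg[OF assms(1)]
  by (intro mult_nonneg_nonneg sum_nonneg) auto

section \<open>Support and covering by cells\<close>

text \<open>
  The complement of the support is a union of null open sets; a countable basis turns it into a
  countable union.
\<close>

lemma AE_measure_support:
  fixes \<mu> :: "'a::second_countable_topology measure"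
  assumes sets: "sets \<mu> = sets borel"
  shows "AE x in \<mu>. x \<in> measure_support \<mu>"
proof -
  obtain B :: "'a set set" where B: "countable B" "topological_basis B"
    using ex_countable_basis by auto
  let ?N = "\<Union>{U \<in> B. emeasure \<mu> U = 0}"
  have "?N \<in> null_sets \<mu>"
    using B sets topological_basis_open[OF B(2)]
    by (intro null_sets_UN'[where N = "\<lambda>U. U" and I = "{U \<in> B. emeasure \<mu> U = 0}", simplified])
      (auto intro!: null_setsI)
  moreover have "{x \<in> space \<mu>. x \<notin> measure_support \<mu>} \<subseteq> ?N"
  proof
    fix x assume "x \<in> {x \<in> space \<mu>. x \<notin> measure_support \<mu>}"
    then obtain U where U: "open U" "x \<in> U" "emeasure \<mu> U = 0"
      by (auto simp: measure_support_def zero_less_iff_neq_zero)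
    then obtain V where V: "V \<in> B" "x \<in> V" "V \<subseteq> U"
      using topological_basisE[OF B(2)] by metis
    then have "emeasure \<mu> V = 0"
      using emeasure_mono[of V U \<mu>] U sets by auto
    with V show "x \<in> ?N" by auto
  qed
  ultimately show ?thesis by (rule AE_I')
qed

lemma closed_measure_support: "closed (measure_support \<mu>)"
proof -
  have "- measure_support \<mu> = \<Union>{U. open U \<and> emeasure \<mu> U = 0}"
    by (auto simp: measure_support_def zero_less_iff_neq_zero)
  moreover have "open (\<Union>{U. open U \<and> emeasure \<mu> U = 0})"
    by (rule open_Union) auto
  ultimately show ?thesis by (simp add: closed_def)
qed

lemma unit_cube_eq_cbox: "(unit_cube :: (real ^ 'd::finite) set) = cbox 0 (\<chi> i. 1)"
  by (auto simp: unit_cube_def mem_box_cart)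

lemma compact_measure_support:
  fixes \<mu> :: "(real ^ 'd::finite) measure"
  assumes "prob_space \<mu>" and sets: "sets \<mu> = sets borel" and "measure \<mu> unit_cube = 1"
  shows "compact (measure_support \<mu>)"
proof -
  interpret prob_space \<mu> by fact
  have space: "space \<mu> = UNIV" using sets_eq_imp_space_eq[OF sets] by simp
  have "emeasure \<mu> (- unit_cube) = 0"
    using prob_compl[of unit_cube] assms
    by (simp add: space emeasure_eq_measure Compl_eq_Diff_UNIV unit_cube_eq_cbox)
  moreover have "open (- (unit_cube :: (real ^ 'd) set))"
    by (simp add: unit_cube_eq_cbox closed_cbox open_Compl)
  ultimately have "measure_support \<mu> \<subseteq> unit_cube"
    unfolding measure_support_def by force
  then have "bounded (measure_support \<mu>)"
    using bounded_cbox bounded_subset unfolding unit_cube_eq_cbox by blast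
  then show ?thesis
    using closed_measure_support by (simp add: compact_eq_bounded_closed)
qed

text \<open>
  A least natural number carries information only if some finite cover exists. Finitely many
  Euclidean balls cover the compact support, and they are contained in the balls of the smaller
  density-sensitive metric.
\<close>

lemma covering_number_attained:
  fixes P :: "((real ^ 'd::finite) \<times> real) measure"
  assumes K: "radial_kernel TYPE('d) K" "0 < \<sigma>" and alpha: "0 \<le> \<alpha>" and "0 < r"
    and compact: "compact (measure_support (X_marginal P))"
    and measurable: "smoothed_density K \<sigma> (X_marginal P) \<in> borel_measurable borel"
  obtains C where "finite C" "card C = covering_number K P \<alpha> \<sigma> r"
    and "measure_support (X_marginal P) \<subseteq> (\<Union>x \<in> C. {z. D_pop K P \<alpha> \<sigma> x z \<le> r})"
proof -
  let ?S = "measure_support (X_marginal P)"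
  let ?covers = "\<lambda>k. \<exists>C. finite C \<and> card C = k \<and> ?S \<subseteq> (\<Union>x \<in> C. {z. D_pop K P \<alpha> \<sigma> x z \<le> r})"
  obtain C where C: "finite C" "?S \<subseteq> (\<Union>x \<in> C. ball x r)"
  proof (rule compactE_image[OF compact, of UNIV "\<lambda>x. ball x r"])
    show "?S \<subseteq> (\<Union>x. ball x r)"
    proof
      fix x show "x \<in> (\<Union>x. ball x r)"
        using \<open>0 < r\<close> by (intro UN_I[of x]) auto
    qed
  qed auto
  have "ball x r \<subseteq> {z. D_pop K P \<alpha> \<sigma> x z \<le> r}" for x
  proof
    fix z assume "z \<in> ball x r"
    moreover have "D_pop K P \<alpha> \<sigma> x z \<le> dist x z"
      unfolding D_pop_def
      by (rule density_metric_le_dist[OF alpha measurable smoothed_density_nonneg[OF K]])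
    ultimately show "z \<in> {z. D_pop K P \<alpha> \<sigma> x z \<le> r}" by simp
  qed
  then have "(\<Union>x \<in> C. ball x r) \<subseteq> (\<Union>x \<in> C. {z. D_pop K P \<alpha> \<sigma> x z \<le> r})"
    by (intro UN_mono) simp_all
  with C have "?covers (card C)" by (intro exI[of _ C] conjI) simp_all
  then have "?covers (covering_number K P \<alpha> \<sigma> r)"
    unfolding covering_number_def by (rule LeastI)
  then show ?thesis using that by blast
qed

lemma inverse_ennreal_antimono: "a \<le> b \<Longrightarrow> inverse b \<le> inverse (a :: ennreal)"
  including ennreal.lifting
  by transfer (rule ereal_inverse_antimono)

text \<open>
  The inequality, unlike equality, holds also at \<open>0\<close> and \<open>\<infinity>\<close>, so cells of measure zero need no
  separate treatment.
\<close>

lemma inverse_ennreal_mult_le_1: "1 / a * a \<le> (1 :: ennreal)"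
proof (cases "a = 0 \<or> a = top")
  case True
  then show ?thesis by (auto simp: divide_ennreal_def)
next
  case False
  then show ?thesis by (simp add: ennreal_divide_times top.not_eq_extremum)
qed

text \<open>
  This is where the covering number enters the risk: on the cell \<open>A c\<close> the integrand is at most
  \<open>1 / \<mu> (A c)\<close>, so each cell contributes at most \<open>1\<close> to the integral.
\<close>

lemma nn_integral_inverse_cell_mass_le:
  fixes q :: "'a \<Rightarrow> ennreal"
  assumes "finite C" and A: "\<And>c. c \<in> C \<Longrightarrow> A c \<in> sets \<mu>"
    and cover: "AE x in \<mu>. x \<in> (\<Union>c \<in> C. A c)"
    and q: "\<And>c x. c \<in> C \<Longrightarrow> x \<in> A c \<Longrightarrow> emeasure \<mu> (A c) \<le> q x"
  shows "(\<integral>\<^sup>+ x. 1 / q x \<partial>\<mu>) \<le> of_nat (card C)"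
proof -
  have "(\<integral>\<^sup>+ x. 1 / q x \<partial>\<mu>) \<le> (\<integral>\<^sup>+ x. (\<Sum>c\<in>C. 1 / emeasure \<mu> (A c) * indicator (A c) x) \<partial>\<mu>)"
  proof (rule nn_integral_mono_AE)
    show "AE x in \<mu>. 1 / q x \<le> (\<Sum>c\<in>C. 1 / emeasure \<mu> (A c) * indicator (A c) x)"
      using cover
    proof eventually_elim
      fix x assume "x \<in> (\<Union>c \<in> C. A c)"
      then obtain c where c: "c \<in> C" "x \<in> A c" by blast
      have "1 / q x \<le> 1 / emeasure \<mu> (A c)"
        unfolding divide_ennreal_def using q[OF c] by (intro mult_left_mono inverse_ennreal_antimono) auto
      also have "\<dots> = 1 / emeasure \<mu> (A c) * indicator (A c) x" using c by simp
      also have "\<dots> \<le> (\<Sum>c\<in>C. 1 / emeasure \<mu> (A c) * indicator (A c) x)"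
        using assms(1) c by (intro member_le_sum) auto
      finally show "1 / q x \<le> (\<Sum>c\<in>C. 1 / emeasure \<mu> (A c) * indicator (A c) x)" .
    qed
  qed
  also have "\<dots> = (\<Sum>c\<in>C. 1 / emeasure \<mu> (A c) * emeasure \<mu> (A c))"
    using A by (simp add: nn_integral_sum nn_integral_cmult_indicator)
  also have "\<dots> \<le> (\<Sum>c\<in>C. 1)"
    by (intro sum_mono inverse_ennreal_mult_le_1)
  finally show ?thesis by simp
qed

section \<open>The inverse of a binomial count\<close>

text \<open>
  The number of sample points in a set is binomial. Splitting off one coordinate of the product
  measure reproduces the recursion of the binomial distribution in the number of trials.
\<close>

lemma nn_integral_count_PiM:
  fixes I :: "nat set"
  assumes "prob_space P" "finite I" and A: "A \<in> sets P"
  shows "(\<integral>\<^sup>+ z. g (card {i \<in> I. z i \<in> A}) \<partial>PiM I (\<lambda>_. P))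
    = (\<integral>\<^sup>+ k. g k \<partial>measure_pmf (binomial_pmf (card I) (measure P A)))"
  using \<open>finite I\<close>
proof (induction I arbitrary: g rule: finite_induct)
  interpret P: prob_space P by fact
  interpret PS: product_sigma_finite "\<lambda>_. P" by unfold_locales
  {
    case empty
    have "0 \<le> measure P A \<and> measure P A \<le> 1" by simp
    then show ?case
      by (simp add: PiM_empty nn_integral_count_space_finite binomial_pmf_0)
  next
    case (insert i I)
    let ?q = "measure P A"
    have q: "0 \<le> ?q" "?q \<le> 1" by auto
    let ?S = "\<lambda>I z. card {j \<in> I. z j \<in> A}"
    have meas: "(\<lambda>z. g (?S I z)) \<in> borel_measurable (PiM I (\<lambda>_. P))" if "finite I" for g :: "nat \<Rightarrow> ennreal" and I :: "nat set"
    proof -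
      have "?S I \<in> measurable (PiM I (\<lambda>_. P)) (count_space UNIV)"
      proof (rule measurable_card)
        fix i
        have "{z \<in> space (PiM I (\<lambda>_. P)). z i \<in> A} \<in> sets (PiM I (\<lambda>_. P))" if "i \<in> I"
          using that A by measurable
        then show "{z \<in> space (PiM I (\<lambda>_. P)). i \<in> {j \<in> I. z j \<in> A}} \<in> sets (PiM I (\<lambda>_. P))"
          by (cases "i \<in> I") simp_all
      qed
      then show ?thesis by (rule measurable_compose) simp
    qed
    have count: "?S (insert i I) (z(i := y)) = (if y \<in> A then Suc (?S I z) else ?S I z)" for z y
    proof -
      have "{j \<in> insert i I. (z(i := y)) j \<in> A} = (if y \<in> A then insert i else id) {j \<in> I. z j \<in> A}"
        using insert.hyps by auto
      then show ?thesis using insert.hyps by simp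
    qed
    have inner: "(\<integral>\<^sup>+ y. g (?S (insert i I) (z(i := y))) \<partial>P)
        = ennreal ?q * g (Suc (?S I z)) + ennreal (1 - ?q) * g (?S I z)" for z
    proof -
      have "(\<integral>\<^sup>+ y. g (?S (insert i I) (z(i := y))) \<partial>P)
          = (\<integral>\<^sup>+ y. g (Suc (?S I z)) * indicator A y + g (?S I z) * indicator (space P - A) y \<partial>P)"
        unfolding count by (intro nn_integral_cong) (auto simp: indicator_def)
      also have "\<dots> = g (Suc (?S I z)) * emeasure P A + g (?S I z) * emeasure P (space P - A)"
        using A by (subst nn_integral_add) (auto simp: nn_integral_cmult_indicator)
      finally show ?thesis
        using P.prob_compl[OF A] by (simp add: P.emeasure_eq_measure mult.commute)
    qed
    have "(\<integral>\<^sup>+ z. g (?S (insert i I) z) \<partial>PiM (insert i I) (\<lambda>_. P))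
        = (\<integral>\<^sup>+ z. (\<integral>\<^sup>+ y. g (?S (insert i I) (z(i := y))) \<partial>P) \<partial>PiM I (\<lambda>_. P))"
      using insert.hyps by (intro PS.product_nn_integral_insert meas finite.insertI)
    also have "\<dots> = (\<integral>\<^sup>+ z. ennreal ?q * g (Suc (?S I z)) + ennreal (1 - ?q) * g (?S I z) \<partial>PiM I (\<lambda>_. P))"
      by (simp only: inner)
    also have "\<dots> = ennreal ?q * (\<integral>\<^sup>+ z. g (Suc (?S I z)) \<partial>PiM I (\<lambda>_. P))
        + ennreal (1 - ?q) * (\<integral>\<^sup>+ z. g (?S I z) \<partial>PiM I (\<lambda>_. P))"
      using meas[OF insert.hyps(1), of "\<lambda>k. g (Suc k)"] meas[OF insert.hyps(1), of g]
      by (simp only: nn_integral_add borel_measurable_times_ennreal borel_measurable_const nn_integral_cmult)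
    also have "\<dots> = (\<integral>\<^sup>+ k. g k \<partial>measure_pmf (binomial_pmf (Suc (card I)) ?q))"
      unfolding insert.IH[of "\<lambda>k. g (Suc k)"] insert.IH[of g]
      using q by (simp add: binomial_pmf_Suc mult.commute)
    finally show ?case using insert.hyps by simp
  }
qed

text \<open>
  The absorption identity \<open>(n + 1) (n choose k) = (k + 1) (n + 1 choose k + 1)\<close> turns the weighted
  probability of \<open>k\<close> successes in \<open>n\<close> trials into that of \<open>k + 1\<close> successes in \<open>n + 1\<close> trials, and
  probabilities sum up to at most \<open>1\<close>.
\<close>

lemma binomial_inverse_Suc_moment:
  assumes q: "0 \<le> q" "q \<le> 1"
  shows "ennreal (real (Suc n) * q) * (\<integral>\<^sup>+ k. ennreal (1 / real (Suc k)) \<partial>measure_pmf (binomial_pmf n q)) \<le> 1"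
proof -
  have shift: "real (Suc n) * q * (pmf (binomial_pmf n q) k * (1 / real (Suc k)))
      = pmf (binomial_pmf (Suc n) q) (Suc k)" for k
  proof -
    have "real (Suc n) * real (n choose k) = real (Suc n choose Suc k) * real (Suc k)"
      by (metis Suc_times_binomial_eq of_nat_mult)
    then have "real (Suc n) * (real (n choose k) / real (Suc k)) = real (Suc n choose Suc k)"
      by (simp add: field_simps del: binomial_Suc_Suc)
    then have "real (Suc n) * (real (n choose k) / real (Suc k)) * (q ^ Suc k * (1 - q) ^ (n - k))
        = real (Suc n choose Suc k) * (q ^ Suc k * (1 - q) ^ (n - k))"
      by simp
    then show ?thesis
      using q by (simp add: pmf_binomial mult_ac del: binomial_Suc_Suc of_nat_Suc)
  qed
  have "ennreal (real (Suc n) * q) * (\<integral>\<^sup>+ k. ennreal (1 / real (Suc k)) \<partial>measure_pmf (binomial_pmf n q))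
      = (\<integral>\<^sup>+ k. ennreal (pmf (binomial_pmf (Suc n) q) (Suc k)) \<partial>count_space UNIV)"
    unfolding nn_integral_measure_pmf using q
    by (subst nn_integral_cmult[symmetric])
      (auto simp: ennreal_mult''[symmetric] shift[symmetric] simp del: of_nat_Suc)
  also have "\<dots> = (\<integral>\<^sup>+ k. ennreal (pmf (binomial_pmf (Suc n) q) k) \<partial>count_space (range Suc))"
    by (rule nn_integral_bij_count_space) (auto simp: bij_betw_def)
  also have "\<dots> = emeasure (measure_pmf (binomial_pmf (Suc n) q)) (range Suc)"
    by (rule nn_integral_pmf)
  also have "\<dots> \<le> 1" by (rule measure_pmf.emeasure_le_1)
  finally show ?thesis .
qed

text \<open>
  The function \<open>1 / max 1 S\<close> of the count \<open>S\<close> covers two sources of error at once: the variance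
  \<open>1 / S\<close> of an average over a nonempty window, and the error \<open>1\<close> made if the window is empty. If \<open>A\<close>
  has measure zero, the right-hand side is \<open>\<infinity>\<close>.
\<close>

lemma nn_integral_inverse_count_le:
  fixes I :: "nat set"
  assumes "prob_space P" "finite I" and A: "A \<in> sets P"
  shows "(\<integral>\<^sup>+ z. ennreal (1 / real (max 1 (card {i \<in> I. z i \<in> A}))) \<partial>PiM I (\<lambda>_. P))
    \<le> ennreal (2 / real (Suc (card I))) * (1 / emeasure P A)"
proof -
  interpret P: prob_space P by fact
  let ?q = "measure P A"
  let ?m = "\<integral>\<^sup>+ k. ennreal (1 / real (Suc k)) \<partial>measure_pmf (binomial_pmf (card I) ?q)"
  show ?thesis
  proof (cases "?q = 0")
    case True
    then have "ennreal (2 / real (Suc (card I))) * (1 / emeasure P A) = top"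
      by (simp add: P.emeasure_eq_measure ennreal_mult_top del: of_nat_Suc)
    then show ?thesis by simp
  next
    case False
    then have q: "0 < ?q" "?q \<le> 1" by (auto simp: zero_less_measure_iff)
    have "(\<integral>\<^sup>+ z. ennreal (1 / real (max 1 (card {i \<in> I. z i \<in> A}))) \<partial>PiM I (\<lambda>_. P))
        = (\<integral>\<^sup>+ k. ennreal (1 / real (max 1 k)) \<partial>measure_pmf (binomial_pmf (card I) ?q))"
      using nn_integral_count_PiM[OF assms, of "\<lambda>k. ennreal (1 / real (max 1 k))"] .
    also have "\<dots> \<le> (\<integral>\<^sup>+ k. ennreal 2 * ennreal (1 / real (Suc k)) \<partial>measure_pmf (binomial_pmf (card I) ?q))"
    proof (intro nn_integral_mono)
      fix k :: nat
      \<comment> \<open>This elementary bound is where the factor \<open>2\<close> comes from.\<close>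
      have "1 / real (max 1 k) \<le> 2 * (1 / real (Suc k))"
        by (cases k) (auto simp: field_simps max_def)
      then show "ennreal (1 / real (max 1 k)) \<le> ennreal 2 * ennreal (1 / real (Suc k))"
        by (subst ennreal_mult[symmetric]) (auto intro: ennreal_leI simp del: of_nat_Suc)
    qed
    also have "\<dots> = ennreal 2 * ?m"
      by (simp add: nn_integral_cmult del: ennreal_numeral)
    also have "?m = ennreal (1 / (real (Suc (card I)) * ?q)) * (ennreal (real (Suc (card I)) * ?q) * ?m)"
      using q by (simp add: mult.assoc[symmetric] ennreal_mult[symmetric] del: of_nat_Suc)
    also have "\<dots> \<le> ennreal (1 / (real (Suc (card I)) * ?q)) * 1"
      using q by (intro mult_left_mono binomial_inverse_Suc_moment) auto
    also have "ennreal 2 * (ennreal (1 / (real (Suc (card I)) * ?q)) * 1)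
        = ennreal (2 / real (Suc (card I))) * (1 / emeasure P A)"
      using q by (simp add: P.emeasure_eq_measure ennreal_mult[symmetric] divide_ennreal
          ennreal_1[symmetric] del: of_nat_Suc ennreal_1 ennreal_numeral)
    finally show ?thesis by (simp add: mult_left_mono)
  qed
qed

section \<open>Regression residuals\<close>

lemma finite_measure_subalgebra_covariate:
  fixes P :: "((real ^ 'd::finite) \<times> real) measure"
  assumes "prob_space P" and sets: "sets P = sets borel"
  shows "finite_measure_subalgebra P (vimage_algebra (space P) fst (borel :: (real ^ 'd) measure))"
proof -
  interpret prob_space P by fact
  have fst: "fst \<in> measurable P borel"
    unfolding measurable_cong_sets[OF sets refl] borel_prod[symmetric] by measurable
  show ?thesis
    by unfold_locales
      (use measurable_sets[OF fst] in \<open>auto simp: subalgebra_def sets_vimage_algebra2\<close>)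
qed

text \<open>
  The residual \<open>Y - f X\<close> has conditional expectation zero given \<open>X\<close>. If the
  product is not integrable, its integral is \<open>0\<close> by convention.
\<close>

lemma regression_residual:
  fixes P :: "((real ^ 'd::finite) \<times> real) measure"
  assumes "prob_space P" and sets: "sets P = sets borel" and f: "regression_version P f"
    and g [measurable]: "g \<in> borel_measurable borel"
  shows "(\<integral>y. (snd y - f (fst y)) * g (fst y) \<partial>P) = 0"
proof -
  interpret prob_space P by fact
  define F where "F = vimage_algebra (space P) fst (borel :: (real ^ 'd) measure)"
  have fst [measurable]: "fst \<in> measurable P borel" and snd [measurable]: "snd \<in> measurable P borel"
    unfolding measurable_cong_sets[OF sets refl] borel_prod[symmetric] by measurable
  have fstF [measurable]: "fst \<in> measurable F borel"
    unfolding F_def by (rule measurable_vimage_algebra1) simp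
  interpret finite_measure_subalgebra P F
    unfolding F_def by (rule finite_measure_subalgebra_covariate) fact+
  have f_meas [measurable]: "f \<in> borel_measurable borel" and Y: "integrable P snd"
    and version: "AE z in P. real_cond_exp P F snd z = f (fst z)"
    using f by (auto simp: regression_version_def F_def)
  have fX: "integrable P (\<lambda>y. f (fst y))"
    by (rule integrable_cong_AE_imp[OF real_cond_exp_int(1)[OF Y]]) (use version in auto)
  have fF: "(\<lambda>y. f (fst y)) \<in> borel_measurable F" by measurable
  let ?e = "\<lambda>y. snd y - f (fst y)"
  have "AE y in P. real_cond_exp P F ?e y = 0"
    using real_cond_exp_diff[OF Y fX] version real_cond_exp_F_meas[OF fX fF]
    by eventually_elim simp
  then have zero: "AE y in P. g (fst y) * real_cond_exp P F ?e y = 0"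
    by auto
  show ?thesis
  proof (cases "integrable P (\<lambda>y. g (fst y) * ?e y)")
    case True
    have "(\<integral>y. g (fst y) * ?e y \<partial>P) = (\<integral>y. g (fst y) * real_cond_exp P F ?e y \<partial>P)"
      using True by (intro real_cond_exp_intg(2)[symmetric]) measurable
    also have "\<dots> = 0" using zero by (rule integral_eq_zero_AE)
    finally show ?thesis by (simp add: mult.commute)
  next
    case False
    then show ?thesis by (simp add: mult.commute not_integrable_integral_eq)
  qed
qed

lemma regression_version_bounded:
  fixes P :: "((real ^ 'd::finite) \<times> real) measure"
  assumes "prob_space P" and sets: "sets P = sets borel" and f: "regression_version P f"
    and Y: "AE y in P. \<bar>snd y\<bar> \<le> M"
  shows "AE y in P. \<bar>f (fst y)\<bar> \<le> M"
proof -
  interpret prob_space P by fact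
  define F where "F = vimage_algebra (space P) fst (borel :: (real ^ 'd) measure)"
  interpret finite_measure_subalgebra P F
    unfolding F_def by (rule finite_measure_subalgebra_covariate) fact+
  have int: "integrable P snd" and version: "AE z in P. real_cond_exp P F snd z = f (fst z)"
    using f by (auto simp: regression_version_def F_def)
  have "AE y in P. real_cond_exp P F snd y \<ge> - M"
    by (rule real_cond_exp_ge_c[OF int]) (use Y in auto)
  moreover have "AE y in P. real_cond_exp P F snd y \<le> M"
    by (rule real_cond_exp_le_c[OF int]) (use Y in auto)
  ultimately show ?thesis using version by eventually_elim auto
qed

text \<open>
  Integrate the \<open>i\<close>-th observation first: with the others fixed, \<open>G\<close> is a function of \<open>X\<^sub>i\<close> alone, and
  the residual is orthogonal to all of these. The condition on \<open>G\<close> says that \<open>G\<close> does not depend on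
  the response \<open>Y\<^sub>i\<close>.
\<close>

lemma residual_uncorrelated:
  fixes P :: "((real ^ 'd::finite) \<times> real) measure" and I :: "'i set"
  assumes P: "prob_space P" and sets: "sets P = sets borel" and f: "regression_version P f"
    and I: "finite I" "i \<in> I"
    and G: "G \<in> borel_measurable (PiM I (\<lambda>_. P))"
    and indep: "\<And>z y y'. fst y = fst y' \<Longrightarrow> G (z(i := y)) = G (z(i := y'))"
    and int: "integrable (PiM I (\<lambda>_. P)) (\<lambda>z. (snd (z i) - f (fst (z i))) * G z)"
  shows "(\<integral>z. (snd (z i) - f (fst (z i))) * G z \<partial>PiM I (\<lambda>_. P)) = 0"
proof -
  interpret P: prob_space P by fact
  interpret PS: product_sigma_finite "\<lambda>_. P" by unfold_locales
  define J where "J = I - {i}"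
  have J: "finite J" "i \<notin> J" "I = insert i J" using I by (auto simp: J_def)
  have space: "space P = UNIV" using sets_eq_imp_space_eq[OF sets] by simp
  have inner: "(\<integral>y. (snd y - f (fst y)) * G (x(i := y)) \<partial>P) = 0" if x: "x \<in> space (PiM J (\<lambda>_. P))" for x
  proof -
    have "(\<lambda>a. (a, 0)) \<in> measurable borel P"
      unfolding measurable_cong_sets[OF refl sets] borel_prod[symmetric] by measurable
    moreover have "(\<lambda>y. x(i := y)) \<in> measurable P (PiM I (\<lambda>_. P))"
      unfolding J(3) using x J(2) by (rule measurable_component_update)
    ultimately have "(\<lambda>a. G (x(i := (a, 0)))) \<in> borel_measurable borel"
      by (intro measurable_compose[OF _ measurable_compose[OF _ G]])
    from regression_residual[OF P sets f this]
    have "(\<integral>y. (snd y - f (fst y)) * G (x(i := (fst y, 0))) \<partial>P) = 0" .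
    then show ?thesis using indep[of "(fst y, 0)" y x for y] by simp
  qed
  have "(\<integral>z. (snd (z i) - f (fst (z i))) * G z \<partial>PiM I (\<lambda>_. P))
      = (\<integral>x. (\<integral>y. (snd y - f (fst y)) * G (x(i := y)) \<partial>P) \<partial>PiM J (\<lambda>_. P))"
    using PS.product_integral_insert[OF J(1,2) int[unfolded J(3)]] J(3) by simp
  also have "\<dots> = (\<integral>x. 0 \<partial>PiM J (\<lambda>_. P))"
    by (rule Bochner_Integration.integral_cong) (simp_all add: inner)
  finally show ?thesis by simp
qed

section \<open>Bias and variance of local averages\<close>

text \<open>
  The bias-variance decomposition, before expectations are taken. With weights \<open>w i = a i / S\<close>, bias
  \<open>b\<close> and residuals \<open>e i\<close>, the error is \<open>b + (\<Sum>i\<in>I. w i * e i)\<close>. Squaring it gives \<open>b\<^sup>2\<close>, mixed terms,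
  and diagonal terms \<open>(w i)\<^sup>2 (e i)\<^sup>2\<close>. In the latter
  \<open>(e i)\<^sup>2 = (Y i)\<^sup>2 - (F i)\<^sup>2 - 2 F i (e i) \<le> M\<^sup>2 - 2 F i (e i)\<close>, which replaces the conditional
  variance by \<open>M\<^sup>2\<close> at the price of one more term linear in \<open>e i\<close>. Everything else is collected as
  \<open>e i\<close> times a factor that does not contain \<open>Y i\<close>, so that it disappears in the mean. The remaining
  \<open>b\<^sup>2 + M\<^sup>2 (\<Sum>i\<in>I. (w i)\<^sup>2)\<close> is at most \<open>\<delta>\<^sup>2 + M\<^sup>2 / S\<close> for a nonempty window. For an empty one all
  weights vanish, and it is \<open>c\<^sup>2\<close>.
\<close>

lemma local_average_squared_error:
  fixes a Y F :: "'i \<Rightarrow> real"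
  assumes I: "finite I" and a: "\<And>i. i \<in> I \<Longrightarrow> a i = 0 \<or> a i = 1"
    and Y: "\<And>i. i \<in> I \<Longrightarrow> \<bar>Y i\<bar> \<le> M" and c: "\<bar>c\<bar> \<le> M"
    and F: "\<And>i. i \<in> I \<Longrightarrow> a i = 1 \<Longrightarrow> \<bar>F i - c\<bar> \<le> \<delta>"
  defines "S \<equiv> \<Sum>i\<in>I. a i"
  defines "w \<equiv> \<lambda>i. a i / S"
  defines "b \<equiv> (\<Sum>i\<in>I. w i * F i) - c"
  defines "e \<equiv> \<lambda>i. Y i - F i"
  shows "((\<Sum>i\<in>I. Y i * a i) / S - c)\<^sup>2 \<le> \<delta>\<^sup>2 + M\<^sup>2 * (1 / max 1 S)
    + (\<Sum>i\<in>I. e i * (2 * b * w i + (\<Sum>j\<in>I - {i}. w i * w j * e j) - 2 * F i * (w i)\<^sup>2))"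
proof -
  have a0: "0 \<le> a i" "(a i)\<^sup>2 = a i" if "i \<in> I" for i using a[OF that] by auto
  have S0: "0 \<le> S" unfolding S_def using a0 by (intro sum_nonneg) auto
  have sumw2: "(\<Sum>i\<in>I. (w i)\<^sup>2) = S / S\<^sup>2"
    unfolding w_def S_def by (simp add: power_divide a0 sum_divide_distrib)
  have main: "b\<^sup>2 + M\<^sup>2 * (\<Sum>i\<in>I. (w i)\<^sup>2) \<le> \<delta>\<^sup>2 + M\<^sup>2 * (1 / max 1 S)"
  proof (cases "S = 0")
    case True
    then have "b = - c" by (simp add: b_def w_def)
    then show ?thesis using True c by (simp add: sumw2 abs_le_square_iff[symmetric] add_increasing)
  next
    case False
    have "S \<ge> 1"
    proof -
      obtain i where i: "i \<in> I" "a i \<noteq> 0" using False unfolding S_def by (metis sum.neutral)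
      then have "a i \<le> S" unfolding S_def using I a0 by (intro member_le_sum) auto
      then show ?thesis using a[OF i(1)] i(2) by simp
    qed
    have sumw: "(\<Sum>i\<in>I. w i) = 1"
      using False by (simp add: w_def sum_divide_distrib[symmetric] S_def[symmetric])
    have "b = (\<Sum>i\<in>I. w i * (F i - c))"
      using sumw by (simp add: b_def algebra_simps sum_subtractf sum_distrib_left[symmetric])
    also have "\<bar>\<dots>\<bar> \<le> (\<Sum>i\<in>I. w i * \<delta>)"
    proof (rule order_trans[OF sum_abs], rule sum_mono)
      fix i assume i: "i \<in> I"
      show "\<bar>w i * (F i - c)\<bar> \<le> w i * \<delta>"
        using a[OF i] F[OF i] S0 by (auto simp: w_def abs_mult divide_right_mono)
    qed
    also have "\<dots> = \<delta>" using sumw by (simp add: sum_distrib_right[symmetric])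
    finally have "b\<^sup>2 \<le> \<delta>\<^sup>2" by (simp add: abs_le_square_iff[symmetric])
    moreover have "S / S\<^sup>2 = 1 / max 1 S" using \<open>S \<ge> 1\<close> by (simp add: power2_eq_square)
    ultimately show ?thesis by (simp only: sumw2)
  qed
  have diag: "(w i * e i)\<^sup>2 \<le> M\<^sup>2 * (w i)\<^sup>2 - e i * (2 * F i * (w i)\<^sup>2)" if "i \<in> I" for i
  proof -
    have "(e i)\<^sup>2 = (Y i)\<^sup>2 - (F i)\<^sup>2 - 2 * F i * e i"
      by (simp add: e_def power2_eq_square algebra_simps)
    also have "\<dots> \<le> M\<^sup>2 - 2 * F i * e i"
      using power_mono[OF Y[OF that], of 2, unfolded power2_abs] zero_le_power2[of "F i"] by linarith
    finally have "(w i)\<^sup>2 * (e i)\<^sup>2 \<le> (w i)\<^sup>2 * (M\<^sup>2 - 2 * F i * e i)"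
      by (intro mult_left_mono) auto
    then show ?thesis by (simp add: power_mult_distrib algebra_simps)
  qed
  \<comment> \<open>Expand the square of bias plus weighted residuals, and separate the diagonal.\<close>
  have "(\<Sum>i\<in>I. Y i * a i) / S - c = b + (\<Sum>i\<in>I. w i * e i)"
    unfolding b_def e_def w_def
    by (simp add: sum_divide_distrib sum.distrib[symmetric] algebra_simps diff_divide_distrib add_divide_distrib sum_subtractf)
  then have "((\<Sum>i\<in>I. Y i * a i) / S - c)\<^sup>2
      = b\<^sup>2 + 2 * b * (\<Sum>i\<in>I. w i * e i) + (\<Sum>i\<in>I. \<Sum>j\<in>I. w i * e i * (w j * e j))"
    by (simp add: power2_eq_square algebra_simps sum_product)
  also have "(\<Sum>i\<in>I. \<Sum>j\<in>I. w i * e i * (w j * e j))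
      = (\<Sum>i\<in>I. (w i * e i)\<^sup>2 + (\<Sum>j\<in>I - {i}. w i * e i * (w j * e j)))"
    using I by (intro sum.cong) (auto simp: sum.remove power2_eq_square)
  also have "\<dots> \<le> (\<Sum>i\<in>I. M\<^sup>2 * (w i)\<^sup>2 - e i * (2 * F i * (w i)\<^sup>2) + (\<Sum>j\<in>I - {i}. w i * e i * (w j * e j)))"
    using diag by (intro sum_mono) auto
  also have "b\<^sup>2 + 2 * b * (\<Sum>i\<in>I. w i * e i) + \<dots> = b\<^sup>2 + M\<^sup>2 * (\<Sum>i\<in>I. (w i)\<^sup>2)
      + (\<Sum>i\<in>I. e i * (2 * b * w i + (\<Sum>j\<in>I - {i}. w i * w j * e j) - 2 * F i * (w i)\<^sup>2))"
    by (simp add: sum_distrib_left sum.distrib[symmetric] algebra_simps)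
  finally show ?thesis using main by simp
qed

definition local_average :: "'i set \<Rightarrow> 'x set \<Rightarrow> ('i \<Rightarrow> 'x \<times> real) \<Rightarrow> real" where
  "local_average I A z =
     (\<Sum>i\<in>I. snd (z i) * indicator A (fst (z i))) / (\<Sum>i\<in>I. indicator A (fst (z i)))"

text \<open>
  The pointwise decomposition is integrated. The terms \<open>e i * G i\<close> have mean zero because \<open>G i\<close>
  involves the responses other than \<open>Y\<^sub>i\<close> only; the binomial estimate bounds the mean of what is
  left.
\<close>

lemma local_average_risk:
  fixes P :: "((real ^ 'd::finite) \<times> real) measure" and I :: "nat set"
  assumes P: "prob_space P" and sets: "sets P = sets borel" and f: "regression_version P f"
    and I: "finite I" and A [measurable]: "A \<in> sets borel"
    and Y: "AE y in P. \<bar>snd y\<bar> \<le> M" and c: "\<bar>c\<bar> \<le> M"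
    and close: "AE y in P. fst y \<in> A \<longrightarrow> \<bar>f (fst y) - c\<bar> \<le> \<delta>"
  shows "(\<integral>\<^sup>+ z. ennreal ((local_average I A z - c)\<^sup>2) \<partial>PiM I (\<lambda>_. P))
    \<le> ennreal (\<delta>\<^sup>2) + ennreal (M\<^sup>2 * (2 / real (Suc (card I)))) * (1 / emeasure P (fst -` A))"
proof -
  interpret P: prob_space P by fact
  let ?Pi = "PiM I (\<lambda>_. P)"
  interpret Pi: prob_space ?Pi by (intro prob_space_PiM P)
  have space: "space P = UNIV" using sets_eq_imp_space_eq[OF sets] by simp
  have [measurable]: "f \<in> borel_measurable borel" using f by (simp add: regression_version_def)
  have "fst \<in> measurable P borel" "snd \<in> measurable P borel"
    unfolding measurable_cong_sets[OF sets refl] borel_prod[symmetric] by measurable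
  then have meas [measurable]: "(\<lambda>z. fst (z i)) \<in> measurable ?Pi borel"
      "(\<lambda>z. snd (z i)) \<in> measurable ?Pi borel" if "i \<in> I" for i
    using that by (auto intro: measurable_compose[OF measurable_component_singleton])
  define a where "a = (\<lambda>i (z :: nat \<Rightarrow> (real ^ 'd) \<times> real). indicator A (fst (z i)) :: real)"
  define S where "S = (\<lambda>z. \<Sum>i\<in>I. a i z)"
  define w where "w = (\<lambda>i z. a i z / S z)"
  define b where "b = (\<lambda>z. (\<Sum>i\<in>I. w i z * f (fst (z i))) - c)"
  define e where "e = (\<lambda>i (z :: nat \<Rightarrow> (real ^ 'd) \<times> real). snd (z i) - f (fst (z i)))"
  define G where "G = (\<lambda>i z. 2 * b z * w i z + (\<Sum>j\<in>I - {i}. w i z * w j z * e j z)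
    - 2 * f (fst (z i)) * (w i z)\<^sup>2)"
  define R where "R = (\<lambda>z. \<delta>\<^sup>2 + M\<^sup>2 * (1 / max 1 (S z)))"
  have a_meas [measurable]: "a i \<in> borel_measurable ?Pi" if "i \<in> I" for i
    unfolding a_def using that by measurable
  have S_meas [measurable]: "S \<in> borel_measurable ?Pi"
    unfolding S_def by measurable
  have w_meas [measurable]: "w i \<in> borel_measurable ?Pi" if "i \<in> I" for i
    unfolding w_def using that by measurable
  have b_meas [measurable]: "b \<in> borel_measurable ?Pi"
    unfolding b_def by measurable
  have e_meas [measurable]: "e i \<in> borel_measurable ?Pi" if "i \<in> I" for i
    unfolding e_def using that by measurable
  have G_meas [measurable]: "G i \<in> borel_measurable ?Pi" if "i \<in> I" for i
    unfolding G_def using that by measurable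
  have R_meas [measurable]: "R \<in> borel_measurable ?Pi"
    unfolding R_def by measurable
  have S_card: "S z = real (card {i \<in> I. z i \<in> fst -` A})" for z
    unfolding S_def a_def using I by (simp add: indicator_def sum.If_cases Int_def)
  have w01: "0 \<le> w i z" "w i z \<le> 1" if "i \<in> I" for i z
  proof -
    have "a i z \<le> S z" unfolding S_def using I that by (intro member_le_sum) (auto simp: a_def)
    moreover have "0 \<le> a i z" by (simp add: a_def)
    ultimately show "0 \<le> w i z" "w i z \<le> 1" by (auto simp: w_def divide_le_eq)
  qed
  have "AE z in ?Pi. \<forall>i\<in>I. \<bar>snd (z i)\<bar> \<le> M \<and> \<bar>f (fst (z i))\<bar> \<le> M
      \<and> (fst (z i) \<in> A \<longrightarrow> \<bar>f (fst (z i)) - c\<bar> \<le> \<delta>)"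
    using Y regression_version_bounded[OF P sets f Y] close
    by (intro AE_finite_allI I AE_PiM_component[where P = "\<lambda>y. \<bar>snd y\<bar> \<le> M \<and> \<bar>f (fst y)\<bar> \<le> M
      \<and> (fst y \<in> A \<longrightarrow> \<bar>f (fst y) - c\<bar> \<le> \<delta>)"] P) auto
  then have typical: "AE z in ?Pi. (\<forall>i\<in>I. \<bar>e i z\<bar> \<le> 2 * M) \<and> (\<forall>i\<in>I. \<bar>f (fst (z i))\<bar> \<le> M)
      \<and> (local_average I A z - c)\<^sup>2 \<le> R z + (\<Sum>i\<in>I. e i z * G i z)"
  proof eventually_elim
    fix z assume z: "\<forall>i\<in>I. \<bar>snd (z i)\<bar> \<le> M \<and> \<bar>f (fst (z i))\<bar> \<le> M
      \<and> (fst (z i) \<in> A \<longrightarrow> \<bar>f (fst (z i)) - c\<bar> \<le> \<delta>)"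
    have "((\<Sum>i\<in>I. snd (z i) * a i z) / (\<Sum>i\<in>I. a i z) - c)\<^sup>2 \<le> R z + (\<Sum>i\<in>I. e i z * G i z)"
      unfolding R_def G_def b_def w_def e_def S_def
      using z by (intro local_average_squared_error I c) (auto simp: a_def indicator_def)
    moreover have "\<forall>i\<in>I. \<bar>e i z\<bar> \<le> 2 * M"
      using z by (force simp: e_def)
    ultimately show "(\<forall>i\<in>I. \<bar>e i z\<bar> \<le> 2 * M) \<and> (\<forall>i\<in>I. \<bar>f (fst (z i))\<bar> \<le> M)
      \<and> (local_average I A z - c)\<^sup>2 \<le> R z + (\<Sum>i\<in>I. e i z * G i z)"
      using z by (simp add: local_average_def a_def)
  qed
  have eG: "integrable ?Pi (\<lambda>z. e i z * G i z)" "(\<integral>z. e i z * G i z \<partial>?Pi) = 0" if i: "i \<in> I" for i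
  proof -
    \<comment> \<open>A crude bound, which only serves to make the uncorrelated terms integrable.\<close>
    define B where "B = 2 * (card I * M + M) + card I * (2 * M) + 2 * M"
    have "AE z in ?Pi. norm (e i z * G i z) \<le> 2 * M * B"
      using typical
    proof eventually_elim
      fix z assume z: "(\<forall>i\<in>I. \<bar>e i z\<bar> \<le> 2 * M) \<and> (\<forall>i\<in>I. \<bar>f (fst (z i))\<bar> \<le> M)
        \<and> (local_average I A z - c)\<^sup>2 \<le> R z + (\<Sum>i\<in>I. e i z * G i z)"
      have M: "0 \<le> M" using c by simp
      have wM: "\<bar>w j z * t\<bar> \<le> B'" if "j \<in> I" "\<bar>t\<bar> \<le> B'" for j t B'
      proof -
        have "w j z * \<bar>t\<bar> \<le> 1 * B'"
          using that w01[OF that(1)] by (intro mult_mono) auto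
        then show ?thesis using w01[OF that(1)] by (simp add: abs_mult)
      qed
      have "\<bar>\<Sum>i\<in>I. w i z * f (fst (z i))\<bar> \<le> (\<Sum>i\<in>I. M)"
        using z by (intro order_trans[OF sum_abs] sum_mono wM) auto
      then have "\<bar>b z\<bar> \<le> card I * M + M"
        unfolding b_def using c by simp
      then have 1: "\<bar>w i z * b z\<bar> \<le> card I * M + M"
        by (rule wM[OF i])
      have "\<bar>\<Sum>j\<in>I - {i}. w i z * w j z * e j z\<bar> \<le> (\<Sum>j\<in>I - {i}. 2 * M)"
        unfolding mult.assoc using z i
        by (intro order_trans[OF sum_abs] sum_mono wM) auto
      also have "\<dots> \<le> card I * (2 * M)"
        using M I card_mono[of I "I - {i}"] by (auto intro!: mult_right_mono)
      finally have 2: "\<bar>\<Sum>j\<in>I - {i}. w i z * w j z * e j z\<bar> \<le> card I * (2 * M)" .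
      have 3: "\<bar>w i z * (w i z * f (fst (z i)))\<bar> \<le> M"
        using z i by (intro wM) auto
      have "\<bar>G i z\<bar> \<le> \<bar>2 * b z * w i z\<bar> + \<bar>\<Sum>j\<in>I - {i}. w i z * w j z * e j z\<bar> + \<bar>2 * f (fst (z i)) * (w i z)\<^sup>2\<bar>"
        unfolding G_def by linarith
      also have "\<dots> \<le> B"
        using 1 2 3 w01[OF i] by (simp add: B_def abs_mult power2_eq_square mult_ac)
      finally show "norm (e i z * G i z) \<le> 2 * M * B"
        using z i M unfolding real_norm_def abs_mult by (intro mult_mono) auto
    qed
    then show int: "integrable ?Pi (\<lambda>z. e i z * G i z)"
      by (intro Pi.integrable_const_bound) (use i in measurable)
    have fst_upd: "fst ((z(i := y)) j) = fst ((z(i := y')) j)" if "fst y = fst y'"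
      for z :: "nat \<Rightarrow> (real ^ 'd) \<times> real" and y y' j using that by simp
    have "G i (z(i := y)) = G i (z(i := y'))" if "fst y = fst y'" for z and y y' :: "(real ^ 'd) \<times> real"
    proof -
      have aw: "a j (z(i := y)) = a j (z(i := y'))" for j
        unfolding a_def using fst_upd[OF that] by simp
      then have w: "w j (z(i := y)) = w j (z(i := y'))" for j
        by (simp add: w_def S_def)
      then have "b (z(i := y)) = b (z(i := y'))"
        unfolding b_def using fst_upd[OF that] by simp
      moreover have "e j (z(i := y)) = e j (z(i := y'))" if "j \<in> I - {i}" for j
        using that by (simp add: e_def)
      ultimately show ?thesis
        unfolding G_def using w that by simp
    qed
    then show "(\<integral>z. e i z * G i z \<partial>?Pi) = 0"
      using residual_uncorrelated[OF P sets f I i G_meas[OF i]] int unfolding e_def by blast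
  qed
  have R_int: "integrable ?Pi R"
  proof (rule Pi.integrable_const_bound)
    have "0 \<le> R z \<and> R z \<le> \<delta>\<^sup>2 + M\<^sup>2 * 1" for z
      unfolding R_def by (intro conjI add_mono mult_left_mono) auto
    then show "AE z in ?Pi. norm (R z) \<le> \<delta>\<^sup>2 + M\<^sup>2 * 1" by (intro AE_I2) simp
  qed measurable
  have "(\<integral>\<^sup>+ z. ennreal ((local_average I A z - c)\<^sup>2) \<partial>?Pi)
      \<le> (\<integral>\<^sup>+ z. ennreal (R z + (\<Sum>i\<in>I. e i z * G i z)) \<partial>?Pi)"
    using typical by (intro nn_integral_mono_AE) (auto intro: ennreal_leI)
  also have "\<dots> = ennreal (\<integral>z. R z + (\<Sum>i\<in>I. e i z * G i z) \<partial>?Pi)"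
  proof (rule nn_integral_eq_integral)
    show "AE z in ?Pi. 0 \<le> R z + (\<Sum>i\<in>I. e i z * G i z)"
      using typical by eventually_elim (meson order_trans zero_le_power2)
  qed (intro Bochner_Integration.integrable_add R_int Bochner_Integration.integrable_sum eG)
  also have "(\<integral>z. R z + (\<Sum>i\<in>I. e i z * G i z) \<partial>?Pi) = (\<integral>z. R z \<partial>?Pi)"
    using R_int eG by simp
  also have "ennreal \<dots> = (\<integral>\<^sup>+ z. ennreal (R z) \<partial>?Pi)"
    by (rule nn_integral_eq_integral[symmetric, OF R_int]) (simp add: R_def)
  also have "\<dots> = (\<integral>\<^sup>+ z. ennreal (\<delta>\<^sup>2) + ennreal (M\<^sup>2) * ennreal (1 / max 1 (S z)) \<partial>?Pi)"
    unfolding R_def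
    by (intro nn_integral_cong, subst ennreal_plus) (simp_all add: ennreal_mult[symmetric])
  also have "\<dots> = ennreal (\<delta>\<^sup>2) + ennreal (M\<^sup>2) * (\<integral>\<^sup>+ z. ennreal (1 / max 1 (S z)) \<partial>?Pi)"
    by (subst nn_integral_add) (simp_all add: nn_integral_cmult Pi.emeasure_space_1)
  also have "(\<integral>\<^sup>+ z. ennreal (1 / max 1 (S z)) \<partial>?Pi)
      = (\<integral>\<^sup>+ z. ennreal (1 / real (max 1 (card {i \<in> I. z i \<in> fst -` A}))) \<partial>?Pi)"
    by (simp add: S_card of_nat_max)
  also have "\<dots> \<le> ennreal (2 / real (Suc (card I))) * (1 / emeasure P (fst -` A))"
    using measurable_sets[OF \<open>fst \<in> measurable P borel\<close> A] space
    by (intro nn_integral_inverse_count_le P I) simp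
  also have "ennreal (M\<^sup>2) * (ennreal (2 / real (Suc (card I))) * (1 / emeasure P (fst -` A)))
      = ennreal (M\<^sup>2 * (2 / real (Suc (card I)))) * (1 / emeasure P (fst -` A))"
    by (subst ennreal_mult) (simp_all add: mult.assoc)
  finally show ?thesis by (simp add: mult_left_mono add_left_mono)
qed

section \<open>Iterated integrals without measurability\<close>

text \<open>
  The integral on the left is a supremum over simple functions below \<open>F\<close>, and Tonelli's theorem
  applies to each of them; \<open>F\<close> itself may be any function. The lemma serves the risk, because the
  estimated metric is an infimum over an uncountable set of curves, which need not depend measurably
  on the unlabeled data.
\<close>

lemma (in pair_sigma_finite) nn_integral_pair_le_iterated:
  "(\<integral>\<^sup>+ w. F w \<partial>(M1 \<Otimes>\<^sub>M M2)) \<le> (\<integral>\<^sup>+ y. (\<integral>\<^sup>+ x. F (x, y) \<partial>M1) \<partial>M2)"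
  unfolding nn_integral_def[of "M1 \<Otimes>\<^sub>M M2"]
proof (rule SUP_least)
  fix g assume "g \<in> {g. simple_function (M1 \<Otimes>\<^sub>M M2) g \<and> g \<le> F}"
  then have g: "simple_function (M1 \<Otimes>\<^sub>M M2) g" and le: "\<And>w. g w \<le> F w"
    by (auto simp: le_fun_def)
  have "integral\<^sup>S (M1 \<Otimes>\<^sub>M M2) g = (\<integral>\<^sup>+ w. g w \<partial>(M1 \<Otimes>\<^sub>M M2))"
    using g by (rule nn_integral_eq_simple_integral[symmetric])
  also have "\<dots> = (\<integral>\<^sup>+ y. (\<integral>\<^sup>+ x. g (x, y) \<partial>M1) \<partial>M2)"
    using nn_integral_snd[of g] borel_measurable_simple_function[OF g] by simp
  also have "\<dots> \<le> (\<integral>\<^sup>+ y. (\<integral>\<^sup>+ x. F (x, y) \<partial>M1) \<partial>M2)"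
    using le by (intro nn_integral_mono)
  finally show "integral\<^sup>S (M1 \<Otimes>\<^sub>M M2) g \<le> (\<integral>\<^sup>+ y. (\<integral>\<^sup>+ x. F (x, y) \<partial>M1) \<partial>M2)" .
qed

section \<open>The estimator for fixed unlabeled data\<close>

lemma local_average_bounded:
  assumes "finite I" and Y: "\<And>i. i \<in> I \<Longrightarrow> \<bar>snd (z i)\<bar> \<le> M" and "0 \<le> M"
  shows "\<bar>local_average I A z\<bar> \<le> M"
proof -
  let ?a = "\<lambda>i. indicator A (fst (z i)) :: real"
  have "\<bar>\<Sum>i\<in>I. snd (z i) * ?a i\<bar> \<le> (\<Sum>i\<in>I. M * ?a i)"
    using Y by (intro order_trans[OF sum_abs] sum_mono) (auto simp: indicator_def)
  then have "\<bar>\<Sum>i\<in>I. snd (z i) * ?a i\<bar> \<le> M * (\<Sum>i\<in>I. ?a i)"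
    by (simp add: sum_distrib_left)
  moreover have "0 \<le> (\<Sum>i\<in>I. ?a i)" by (simp add: sum_nonneg)
  ultimately show ?thesis
    using \<open>0 \<le> M\<close> unfolding local_average_def abs_divide
    by (cases "(\<Sum>i\<in>I. ?a i) = 0") (auto simp: divide_le_eq)
qed

locale semisupervised_regression =
  fixes P :: "((real ^ 'd::finite) \<times> real) measure"
    and K :: "real \<Rightarrow> real"
    and f :: "real ^ 'd \<Rightarrow> real"
    and n m :: nat
    and h \<alpha> \<sigma> L M :: real
  assumes kernel: "radial_kernel TYPE('d) K"
    and h: "h > 0" and alpha: "\<alpha> \<ge> 0" and sigma: "\<sigma> > 0" and L: "L > 0"
    and P_class: "P \<in> P_class K \<alpha> \<sigma> L"
    and regression: "regression_version P f"
    and bounded: "AE z in P. \<bar>snd z\<bar> \<le> M"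
begin

abbreviation "PX \<equiv> X_marginal P"

abbreviation window :: "(nat \<Rightarrow> real ^ 'd) \<Rightarrow> real ^ 'd \<Rightarrow> (real ^ 'd) set" where
  "window u x \<equiv> {y. D_hat K m u \<alpha> \<sigma> x y \<le> h}"

lemma prob_P: "prob_space P" and sets_P: "sets P = sets borel"
  using P_class by (auto simp: P_class_def)

lemma sets_PX: "sets PX = sets borel"
  by (simp add: X_marginal_def)

lemma fst_measurable: "fst \<in> measurable P borel"
  unfolding measurable_cong_sets[OF sets_P refl] borel_prod[symmetric] by measurable

lemma prob_PX: "prob_space PX"
  unfolding X_marginal_def by (rule prob_space.prob_space_distr[OF prob_P fst_measurable])

lemma AE_PX_iff:
  assumes "{x. Q x} \<in> sets borel"
  shows "(AE x in PX. Q x) \<longleftrightarrow> (AE y in P. Q (fst y))"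
  unfolding X_marginal_def using assms by (intro AE_distr_iff fst_measurable) simp

lemma f_measurable [measurable]: "f \<in> borel_measurable borel"
  using regression by (simp add: regression_version_def)

lemma M_nonneg: "0 \<le> M"
proof -
  have "AE z in P. 0 \<le> M" using bounded by eventually_elim simp
  then show ?thesis by (simp add: prob_space.AE_const[OF prob_P])
qed

lemma D_pop_triangle: "D_pop K P \<alpha> \<sigma> x z \<le> D_pop K P \<alpha> \<sigma> x y + D_pop K P \<alpha> \<sigma> y z"
  and D_pop_sym: "D_pop K P \<alpha> \<sigma> x y = D_pop K P \<alpha> \<sigma> y x"
  and D_pop_measurable: "(\<lambda>(x, y). D_pop K P \<alpha> \<sigma> x y) \<in> borel_measurable (borel \<Otimes>\<^sub>M borel)"
  and smoothed_PX_measurable: "smoothed_density K \<sigma> PX \<in> borel_measurable borel"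
proof -
  interpret prob_space PX by (rule prob_PX)
  show p: "smoothed_density K \<sigma> PX \<in> borel_measurable borel"
    by (intro smoothed_density_measurable kernel sigma sets_PX sigma_finite_measure_axioms)
  note p = alpha p smoothed_density_nonneg[OF kernel sigma]
  show "D_pop K P \<alpha> \<sigma> x z \<le> D_pop K P \<alpha> \<sigma> x y + D_pop K P \<alpha> \<sigma> y z"
    "D_pop K P \<alpha> \<sigma> x y = D_pop K P \<alpha> \<sigma> y x"
    "(\<lambda>(x, y). D_pop K P \<alpha> \<sigma> x y) \<in> borel_measurable (borel \<Otimes>\<^sub>M borel)"
    unfolding D_pop_def
    by (rule density_metric_triangle[OF p] density_metric_sym[OF p] density_metric_measurable[OF p])+
qed

lemma D_hat_measurable [measurable]:
  fixes u :: "nat \<Rightarrow> real ^ 'd"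
  shows   "(\<lambda>(x, y). D_hat K m u \<alpha> \<sigma> x y) \<in> borel_measurable (borel \<Otimes>\<^sub>M borel)"
  unfolding D_hat_def
  by (rule density_metric_measurable[OF alpha density_estimate_measurable[OF kernel sigma]
        density_estimate_nonneg[OF kernel sigma]])

lemma window_graph_measurable:
  fixes u :: "nat \<Rightarrow> real ^ 'd"
  shows   "{(x, y). D_hat K m u \<alpha> \<sigma> x y \<le> h} \<in> sets (borel \<Otimes>\<^sub>M borel)"
proof -
  have "{w \<in> space (borel \<Otimes>\<^sub>M borel). (case w of (x, y) \<Rightarrow> D_hat K m u \<alpha> \<sigma> x y) \<le> h}
      \<in> sets (borel \<Otimes>\<^sub>M borel)"
    by measurable
  then show ?thesis by (simp add: space_pair_measure case_prod_beta')
qed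

lemma window_measurable: "window u x \<in> sets borel"
  using sets_Pair1[OF window_graph_measurable[of u], of x] by (simp add: vimage_def)

text \<open>
  The factor \<open>h\<^sup>-\<^sup>d\<close> cancels, and the box kernel of a nonnegative distance is the indicator of a
  window.
\<close>

lemma f_hat_eq_local_average:
  "f_hat K n m h \<alpha> \<sigma> z u x = local_average {1..n} (window u x) z"
proof -
  have "Q_scaled CARD('d) h (D_hat K m u \<alpha> \<sigma> x y) = (1 / h ^ CARD('d)) * indicator (window u x) y" for y
  proof -
    have "0 \<le> D_hat K m u \<alpha> \<sigma> x y"
      unfolding D_hat_def
      by (rule density_metric_nonneg[OF alpha density_estimate_measurable[OF kernel sigma]
            density_estimate_nonneg[OF kernel sigma]])
    then show ?thesis using h by (simp add: Q_scaled_def Q_ball_def indicator_def)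
  qed
  then have "f_hat K n m h \<alpha> \<sigma> z u x
      = ((1 / h ^ CARD('d)) * (\<Sum>i = 1..n. snd (z i) * indicator (window u x) (fst (z i))))
        / ((1 / h ^ CARD('d)) * (\<Sum>i = 1..n. indicator (window u x) (fst (z i))))"
    unfolding f_hat_def by (simp only: sum_distrib_left mult.left_commute)
  then show ?thesis using h by (simp add: local_average_def)
qed

text \<open>
  Since the estimated metric is continuous, the graph of \<open>x \<mapsto> window u x\<close> is a Borel set; here \<open>u\<close> is
  a fixed parameter.
\<close>

lemma squared_error_measurable:
  "(\<lambda>(z, x). ennreal ((f_hat K n m h \<alpha> \<sigma> z u x - f x)\<^sup>2))
    \<in> borel_measurable (labeled_law P n \<Otimes>\<^sub>M PX)"
proof -
  let ?W = "{(x, y). D_hat K m u \<alpha> \<sigma> x y \<le> h}"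
  have [measurable]: "fst \<in> measurable P borel" "snd \<in> measurable P borel"
    unfolding measurable_cong_sets[OF sets_P refl] borel_prod[symmetric] by measurable
  have [measurable]: "?W \<in> sets (borel \<Otimes>\<^sub>M borel)" by (rule window_graph_measurable)
  have [measurable_cong]: "sets PX = sets borel" by (rule sets_PX)
  have "(\<lambda>w. ennreal (((\<Sum>i = 1..n. snd (fst w i) * indicator ?W (snd w, fst (fst w i)))
      / (\<Sum>i = 1..n. indicator ?W (snd w, fst (fst w i))) - f (snd w))\<^sup>2))
      \<in> borel_measurable (labeled_law P n \<Otimes>\<^sub>M PX)"
    unfolding labeled_law_def by measurable
  then show ?thesis
    by (simp add: f_hat_eq_local_average local_average_def case_prod_beta' indicator_def)
qed

text \<open>
  Used for atypical unlabeled data: estimator and regression function are both bounded by \<open>M\<close>.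
\<close>

lemma inner_risk_le_trivial:
  "(\<integral>\<^sup>+ z. (\<integral>\<^sup>+ x. ennreal ((f_hat K n m h \<alpha> \<sigma> z u x - f x)\<^sup>2) \<partial>PX) \<partial>labeled_law P n)
    \<le> ennreal (4 * M\<^sup>2)"
proof -
  interpret Z: prob_space "labeled_law P n"
    unfolding labeled_law_def by (intro prob_space_PiM prob_P)
  interpret X: prob_space PX by (rule prob_PX)
  have fM: "AE x in PX. \<bar>f x\<bar> \<le> M"
    using regression_version_bounded[OF prob_P sets_P regression bounded]
    by (subst AE_PX_iff) auto
  have "AE z in labeled_law P n. \<forall>i\<in>{1..n}. \<bar>snd (z i)\<bar> \<le> M"
    unfolding labeled_law_def
    by (intro AE_finite_allI AE_PiM_component[where P = "\<lambda>y. \<bar>snd y\<bar> \<le> M"] prob_P bounded) auto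
  then have "AE z in labeled_law P n.
      (\<integral>\<^sup>+ x. ennreal ((f_hat K n m h \<alpha> \<sigma> z u x - f x)\<^sup>2) \<partial>PX) \<le> ennreal (4 * M\<^sup>2)"
  proof eventually_elim
    fix z :: "nat \<Rightarrow> (real ^ 'd) \<times> real"
    assume z: "\<forall>i\<in>{1..n}. \<bar>snd (z i)\<bar> \<le> M"
    have "AE x in PX. ennreal ((f_hat K n m h \<alpha> \<sigma> z u x - f x)\<^sup>2) \<le> ennreal (4 * M\<^sup>2)"
      using fM
    proof eventually_elim
      fix x assume "\<bar>f x\<bar> \<le> M"
      moreover have "\<bar>f_hat K n m h \<alpha> \<sigma> z u x\<bar> \<le> M"
        unfolding f_hat_eq_local_average using z M_nonneg by (intro local_average_bounded) auto
      ultimately have "\<bar>f_hat K n m h \<alpha> \<sigma> z u x - f x\<bar> \<le> 2 * M" by linarith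
      from power_mono[OF this, of 2]
      show "ennreal ((f_hat K n m h \<alpha> \<sigma> z u x - f x)\<^sup>2) \<le> ennreal (4 * M\<^sup>2)"
        by (intro ennreal_leI) (simp add: power_mult_distrib)
    qed
    from nn_integral_mono_AE[OF this]
    show "(\<integral>\<^sup>+ x. ennreal ((f_hat K n m h \<alpha> \<sigma> z u x - f x)\<^sup>2) \<partial>PX) \<le> ennreal (4 * M\<^sup>2)"
      by (simp add: X.emeasure_space_1)
  qed
  from nn_integral_mono_AE[OF this] show ?thesis by (simp add: Z.emeasure_space_1)
qed

text \<open>
  Fixed unlabeled data with an accurate density estimate. The bias is at most \<open>L h exp (\<alpha> \<epsilon>)\<close>, since
  points in a window are close also in the population metric, for which the regression function is
  Lipschitz. The variance at \<open>x\<close> is of order \<open>1 / (n q x)\<close>, where \<open>q x\<close> is the mass of the window, and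
  the covering number bounds the mean of \<open>1 / q x\<close>.
\<close>

lemma inner_risk_le:
  assumes close: "\<And>x. \<bar>density_estimate K \<sigma> m u x - smoothed_density K \<sigma> PX x\<bar> \<le> \<epsilon>"
  shows "(\<integral>\<^sup>+ z. (\<integral>\<^sup>+ x. ennreal ((f_hat K n m h \<alpha> \<sigma> z u x - f x)\<^sup>2) \<partial>PX) \<partial>labeled_law P n)
    \<le> ennreal (L\<^sup>2 * (h * exp (\<alpha> * \<epsilon>))\<^sup>2
        + M\<^sup>2 * (2 / real (Suc n)) * real (covering_number K P \<alpha> \<sigma> (exp (- \<epsilon> * \<alpha>) * h / 2)))"
proof -
  interpret Z: prob_space "labeled_law P n"
    unfolding labeled_law_def by (intro prob_space_PiM prob_P)
  interpret P: prob_space P by (rule prob_P)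
  interpret X: prob_space PX by (rule prob_PX)
  interpret ZX: pair_sigma_finite "labeled_law P n" PX by unfold_locales
  let ?D = "D_pop K P \<alpha> \<sigma>" and ?D' = "D_hat K m u \<alpha> \<sigma>"
  define r where "r = exp (- \<epsilon> * \<alpha>) * h / 2"
  define \<delta> where "\<delta> = L * (h * exp (\<alpha> * \<epsilon>))"
  define q where "q x = emeasure PX (window u x)" for x
  define v where "v = M\<^sup>2 * (2 / real (Suc n))"
  have r: "0 < r" using h by (simp add: r_def)
  have v: "0 \<le> v" by (simp add: v_def)
  have q_eq: "q x = emeasure P (fst -` window u x)" for x
    using sets_eq_imp_space_eq[OF sets_P] window_measurable fst_measurable
    by (simp add: q_def X_marginal_def emeasure_distr)
  have q_meas [measurable]: "q \<in> borel_measurable PX"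
    using X.measurable_emeasure_Pair[of "{(x, y). ?D' x y \<le> h}" PX] window_graph_measurable[of u] sets_PX
    by (simp add: q_def[abs_def] vimage_def cong: sets_pair_measure_cong)
  note p = smoothed_PX_measurable smoothed_density_nonneg[OF kernel sigma]
  note p' = density_estimate_measurable[OF kernel sigma, of m u] density_estimate_nonneg[OF kernel sigma]
  have D'_le: "?D' x y \<le> exp (\<alpha> * \<epsilon>) * ?D x y" for x y
    unfolding D_hat_def D_pop_def
    by (rule density_metric_perturb[OF alpha p' p]) (use close in \<open>force simp: abs_le_iff algebra_simps\<close>)
  have D_le: "?D x y \<le> exp (\<alpha> * \<epsilon>) * ?D' x y" for x y
    unfolding D_hat_def D_pop_def
    by (rule density_metric_perturb[OF alpha p p']) (use close in \<open>force simp: abs_le_iff algebra_simps\<close>)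

  have cube: "measure PX unit_cube = 1" using P_class by (simp add: P_class_def)
  obtain C where C: "finite C" "card C = covering_number K P \<alpha> \<sigma> r"
    and cover: "measure_support PX \<subseteq> (\<Union>c \<in> C. {z. ?D c z \<le> r})"
    using covering_number_attained[OF kernel sigma alpha r
        compact_measure_support[OF prob_PX sets_PX cube] smoothed_PX_measurable] .
  \<comment> \<open>Two points in a ball of radius \<open>r\<close> are at distance at most \<open>2
    r\<close>, and \<open>r\<close> is chosen so that their estimated distance is at most \<open>exp
    (\<alpha> \<epsilon>) * (2 r) = h\<close>: the window of a point contains every ball of the
    cover that contains the point.\<close>
  have inverse_mass: "(\<integral>\<^sup>+ x. 1 / q x \<partial>PX) \<le> of_nat (card C)"
  proof (rule nn_integral_inverse_cell_mass_le[OF C(1), where A = "\<lambda>c. {z. ?D c z \<le> r}"])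
    show cell: "{z. ?D c z \<le> r} \<in> sets PX" for c
    proof -
      have "(\<lambda>z. ?D c z) \<in> borel_measurable borel"
        using measurable_Pair2[OF D_pop_measurable, of c] by simp
      then show ?thesis by (simp add: sets_PX)
    qed
    show "AE x in PX. x \<in> (\<Union>c \<in> C. {z. ?D c z \<le> r})"
      using AE_measure_support[OF sets_PX] by eventually_elim (use cover in blast)
    fix c x assume x: "x \<in> {z. ?D c z \<le> r}"
    have "{z. ?D c z \<le> r} \<subseteq> window u x"
    proof
      fix y assume y: "y \<in> {z. ?D c z \<le> r}"
      have "?D x y \<le> ?D c x + ?D c y"
        using D_pop_triangle[of x y c] by (simp add: D_pop_sym[of x c])
      also have "\<dots> \<le> 2 * r" using x y by simp
      finally have "exp (\<alpha> * \<epsilon>) * ?D x y \<le> exp (\<alpha> * \<epsilon>) * (2 * r)" by simp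
      also have "\<dots> = h" by (simp add: r_def exp_minus mult.commute)
      finally show "y \<in> window u x" using D'_le[of x y] by simp
    qed
    then show "emeasure PX {z. ?D c z \<le> r} \<le> q x"
      unfolding q_def by (intro emeasure_mono) (simp_all add: sets_PX window_measurable)
  qed

  \<comment> \<open>The Lipschitz condition holds for one version \<open>f0\<close> of the
    regression function; \<open>f\<close> agrees with it almost surely.\<close>
  obtain f0 where f0: "regression_version P f0"
    and lip: "\<And>x1 x2. x1 \<in> unit_cube \<Longrightarrow> x2 \<in> unit_cube \<Longrightarrow> \<bar>f0 x1 - f0 x2\<bar> \<le> L * ?D x1 x2"
    using P_class by (auto simp: P_class_def)
  have [measurable]: "f0 \<in> borel_measurable borel" using f0 by (simp add: regression_version_def)
  have in_cube: "AE x in PX. x \<in> unit_cube"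
    using cube by (intro X.AE_prob_1) simp
  have f_f0: "AE y in P. f (fst y) = f0 (fst y)"
  proof -
    have "AE y in P. real_cond_exp P (vimage_algebra (space P) fst borel) snd y = f (fst y)"
      and "AE y in P. real_cond_exp P (vimage_algebra (space P) fst borel) snd y = f0 (fst y)"
      using regression f0 by (simp_all add: regression_version_def)
    then show ?thesis by eventually_elim simp
  qed
  have typical: "AE x in PX. x \<in> unit_cube \<and> f x = f0 x \<and> \<bar>f x\<bar> \<le> M"
  proof -
    have "AE x in PX. f x = f0 x"
      using f_f0 by (subst AE_PX_iff) measurable
    moreover have "AE x in PX. \<bar>f x\<bar> \<le> M"
      using regression_version_bounded[OF prob_P sets_P regression bounded]
      by (subst AE_PX_iff) measurable
    ultimately show ?thesis using in_cube by eventually_elim simp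
  qed
  have typical': "AE y in P. fst y \<in> unit_cube \<and> f (fst y) = f0 (fst y)"
  proof -
    have "AE y in P. fst y \<in> unit_cube"
      using in_cube by (subst (asm) AE_PX_iff) (simp_all add: unit_cube_eq_cbox)
    with f_f0 show ?thesis by eventually_elim simp
  qed

  have pointwise: "AE x in PX. (\<integral>\<^sup>+ z. ennreal ((f_hat K n m h \<alpha> \<sigma> z u x - f x)\<^sup>2) \<partial>labeled_law P n)
      \<le> ennreal (\<delta>\<^sup>2) + ennreal v * (1 / q x)"
    using typical
  proof eventually_elim
    fix x assume x: "x \<in> unit_cube \<and> f x = f0 x \<and> \<bar>f x\<bar> \<le> M"
    have "AE y in P. fst y \<in> window u x \<longrightarrow> \<bar>f (fst y) - f x\<bar> \<le> \<delta>"
      using typical'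
    proof eventually_elim
      fix y assume y: "fst y \<in> unit_cube \<and> f (fst y) = f0 (fst y)"
      show "fst y \<in> window u x \<longrightarrow> \<bar>f (fst y) - f x\<bar> \<le> \<delta>"
      proof
        assume "fst y \<in> window u x"
        then have "exp (\<alpha> * \<epsilon>) * ?D' x (fst y) \<le> exp (\<alpha> * \<epsilon>) * h" by simp
        from order_trans[OF D_le this] have "?D x (fst y) \<le> h * exp (\<alpha> * \<epsilon>)"
          by (simp add: mult.commute)
        then have "L * ?D x (fst y) \<le> \<delta>" using L by (simp add: \<delta>_def)
        then show "\<bar>f (fst y) - f x\<bar> \<le> \<delta>" using lip[of x "fst y"] x y by (simp add: abs_minus_commute)
      qed
    qed
    moreover have "\<bar>f x\<bar> \<le> M" using x by blast
    ultimately have "(\<integral>\<^sup>+ z. ennreal ((local_average {1..n} (window u x) z - f x)\<^sup>2) \<partial>PiM {1..n} (\<lambda>_. P))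
        \<le> ennreal (\<delta>\<^sup>2) + ennreal (M\<^sup>2 * (2 / real (Suc (card {1..n}))))
            * (1 / emeasure P (fst -` window u x))"
      by (intro local_average_risk[OF prob_P sets_P regression finite_atLeastAtMost window_measurable bounded])
    then
    show "(\<integral>\<^sup>+ z. ennreal ((f_hat K n m h \<alpha> \<sigma> z u x - f x)\<^sup>2) \<partial>labeled_law P n)
        \<le> ennreal (\<delta>\<^sup>2) + ennreal v * (1 / q x)"
      by (simp add: f_hat_eq_local_average labeled_law_def q_eq v_def)
  qed
  have "(\<integral>\<^sup>+ z. (\<integral>\<^sup>+ x. ennreal ((f_hat K n m h \<alpha> \<sigma> z u x - f x)\<^sup>2) \<partial>PX) \<partial>labeled_law P n)
      = (\<integral>\<^sup>+ x. (\<integral>\<^sup>+ z. ennreal ((f_hat K n m h \<alpha> \<sigma> z u x - f x)\<^sup>2) \<partial>labeled_law P n) \<partial>PX)"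
    by (rule ZX.Fubini'[symmetric, OF squared_error_measurable])
  also have "\<dots> \<le> (\<integral>\<^sup>+ x. ennreal (\<delta>\<^sup>2) + ennreal v * (1 / q x) \<partial>PX)"
    using pointwise by (rule nn_integral_mono_AE)
  also have "\<dots> = ennreal (\<delta>\<^sup>2) + ennreal v * (\<integral>\<^sup>+ x. 1 / q x \<partial>PX)"
    by (subst nn_integral_add) (simp_all add: nn_integral_cmult X.emeasure_space_1)
  also have "\<dots> \<le> ennreal (\<delta>\<^sup>2) + ennreal v * of_nat (card C)"
    using inverse_mass by (intro add_left_mono mult_left_mono) auto
  also have "\<dots> = ennreal (\<delta>\<^sup>2 + v * real (card C))"
    using v by (simp add: ennreal_mult ennreal_of_nat_eq_real_of_nat)
  finally show ?thesis
    by (simp add: \<delta>_def v_def C(2) r_def power_mult_distrib del: of_nat_Suc)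
qed

end

section \<open>The risk bound\<close>

lemma sup_norm_le_iff:
  assumes "0 \<le> \<epsilon>"
  shows "sup_norm g \<le> ennreal \<epsilon> \<longleftrightarrow> (\<forall>x. \<bar>g x\<bar> \<le> \<epsilon>)"
  unfolding sup_norm_def using assms by (simp add: SUP_le_iff)

theorem theorem4p1:
  fixes P :: "((real ^ 'd::finite) \<times> real) measure"
    and K :: "real \<Rightarrow> real"
    and f :: "real ^ 'd \<Rightarrow> real"
    and n m :: nat
    and h \<alpha> \<sigma> L M \<epsilon> :: real
  assumes "radial_kernel TYPE('d) K"
    and "n \<ge> 1" and "m \<ge> 1"
    and "h > 0" and "\<alpha> \<ge> 0" and "\<sigma> > 0" and "L > 0" and "M > 0" and "\<epsilon> \<ge> 0"
    and "P \<in> P_class K \<alpha> \<sigma> L"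
    and "regression_version P f"
    and "AE z in P. \<bar>snd z\<bar> \<le> M"
    and "good_event K \<sigma> P m \<epsilon> \<in> sets (completion (unlabeled_law P m))"
    and "measure (completion (unlabeled_law P m))
           (space (unlabeled_law P m) - good_event K \<sigma> P m \<epsilon>) \<le> 1 / real m"
  shows "risk P f n m (f_hat K n m h \<alpha> \<sigma>) \<le>
    ennreal (L\<^sup>2 * (h * exp (\<alpha> * \<epsilon>))\<^sup>2
      + M\<^sup>2 * (2 + 1 / exp 1) * real (covering_number K P \<alpha> \<sigma> (exp (- \<epsilon> * \<alpha>) * h / 2)) / real n
      + 4 * M\<^sup>2 / real m)"
proof -
  interpret semisupervised_regression P K f n m h \<alpha> \<sigma> L M
    using assms by unfold_locales
  interpret Z: prob_space "labeled_law P n"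
    unfolding labeled_law_def by (intro prob_space_PiM prob_P)
  interpret U: prob_space "unlabeled_law P m"
    unfolding unlabeled_law_def by (intro prob_space_PiM prob_PX)
  interpret ZU: pair_sigma_finite "labeled_law P n" "unlabeled_law P m" by unfold_locales
  interpret U': prob_space "completion (unlabeled_law P m)"
    by (rule prob_spaceI) (simp add: U.emeasure_space_1)
  let ?bad = "space (unlabeled_law P m) - good_event K \<sigma> P m \<epsilon>"
  let ?N = "real (covering_number K P \<alpha> \<sigma> (exp (- \<epsilon> * \<alpha>) * h / 2))"
  define J where "J u = (\<integral>\<^sup>+ z. (\<integral>\<^sup>+ x. ennreal ((f_hat K n m h \<alpha> \<sigma> z u x - f x)\<^sup>2) \<partial>PX)
    \<partial>labeled_law P n)" for u
  define B where "B = L\<^sup>2 * (h * exp (\<alpha> * \<epsilon>))\<^sup>2 + M\<^sup>2 * (2 / real (Suc n)) * ?N"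
  have B0: "0 \<le> B" by (simp add: B_def)
  have bad: "?bad \<in> sets (completion (unlabeled_law P m))"
    using sets.compl_sets[OF assms(13)] by simp
  have J_le: "J u \<le> ennreal B + ennreal (4 * M\<^sup>2) * indicator ?bad u"
    if u: "u \<in> space (unlabeled_law P m)" for u
  proof (cases "u \<in> good_event K \<sigma> P m \<epsilon>")
    case True
    then have "\<bar>density_estimate K \<sigma> m u x - smoothed_density K \<sigma> PX x\<bar> \<le> \<epsilon>" for x
      by (simp add: good_event_def sup_norm_le_iff[OF \<open>0 \<le> \<epsilon>\<close>])
    from inner_risk_le[OF this] show ?thesis using True by (simp add: J_def B_def)
  next
    case False
    then have "J u \<le> ennreal (4 * M\<^sup>2) * indicator ?bad u"
      using inner_risk_le_trivial[of u] u by (simp add: J_def)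
    then show ?thesis by (simp add: add_increasing)
  qed
  \<comment> \<open>The unlabeled data are integrated last, because good and bad data are treated
    differently.\<close>
  have "risk P f n m (f_hat K n m h \<alpha> \<sigma>) \<le> (\<integral>\<^sup>+ u. J u \<partial>unlabeled_law P m)"
    unfolding risk_def J_def
    by (rule order_trans[OF ZU.nn_integral_pair_le_iterated]) simp
  \<comment> \<open>The good event is measurable for the completed law, so the integral passes to it.\<close>
  also have "\<dots> = (\<integral>\<^sup>+ u. J u \<partial>completion (unlabeled_law P m))"
    by (simp add: nn_integral_completion)
  also have "\<dots> \<le> (\<integral>\<^sup>+ u. ennreal B + ennreal (4 * M\<^sup>2) * indicator ?bad u \<partial>completion (unlabeled_law P m))"
    using J_le by (intro nn_integral_mono) simp
  also have "\<dots> = ennreal B + ennreal (4 * M\<^sup>2) * emeasure (completion (unlabeled_law P m)) ?bad"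
    using bad U'.emeasure_space_1
    by (subst nn_integral_add) (auto simp: nn_integral_cmult_indicator simp del: space_completion)
  also have "\<dots> \<le> ennreal B + ennreal (4 * M\<^sup>2) * ennreal (1 / real m)"
    using assms(14) by (intro add_left_mono mult_left_mono) (auto simp: U'.emeasure_eq_measure intro: ennreal_leI)
  also have "\<dots> = ennreal (B + 4 * M\<^sup>2 / real m)"
    using B0 by (simp add: ennreal_mult[symmetric] ennreal_plus[symmetric] del: ennreal_plus)
  also have "\<dots> \<le> ennreal (L\<^sup>2 * (h * exp (\<alpha> * \<epsilon>))\<^sup>2 + M\<^sup>2 * (2 + 1 / exp 1) * ?N / real n + 4 * M\<^sup>2 / real m)"
  proof -
    \<comment> \<open>The empty window was absorbed into the variance term, so \<open>2 / (n +
      1)\<close> takes the place of \<open>(2 + 1 / e) / n\<close>.\<close>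
    have "2 / real (Suc n) \<le> (2 + 1 / exp 1) / real n"
      using \<open>n \<ge> 1\<close> by (intro frac_le) auto
    then have "M\<^sup>2 * ?N * (2 / real (Suc n)) \<le> M\<^sup>2 * ?N * ((2 + 1 / exp 1) / real n)"
      by (intro mult_left_mono) auto
    then show ?thesis by (intro ennreal_leI) (simp add: B_def mult_ac)
  qed
  finally show ?thesis .
qed

end
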